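(* Let $X$ be a semigraph algebra with generator sets $\mathcal{P}$ and $\mathcal{T}$, let $Y$ be the quotient of $X$ by a subset of the fiber space of $X$ (that is, by the two-sided self-adjoint ideal generated by that subset), and let $f:X\to Y$ be the quotient map. Then $Y$ is a semigraph algebra for the new generator sets $\mathcal{P}_{\rm new}=f(\mathcal{P})$ and $\mathcal{T}_{\rm new}=f(\mathcal{T})\setminus\{0\}$. Moreover the restriction of $f$ to $\{t\in\mathcal{T}: f(t)\in\mathcal{T}_{\rm new}\}$ is a bijection onto $\mathcal{T}_{\rm new}$.
   Context: Conventions. $k$ is an index set; $\mathbb{N}_0=\{0,1,2,\dots\}$; $\mathbb{Z}^k$ and $\mathbb{N}_0^k$ denote the finitely supported functions $k\to\mathbb{Z}$, $k\to\mathbb{N}_0$, with coordinatewise order, and $\vee$ is coordinatewise maximum. A $*$-algebra is an algebra over $\mathbb{C}$ with involution; a partial isometry is an element $s$ with $ss^*s=s$; a projection is $p$ with $p=p^2=p^*$. Semigraphs. A semimultiplicative set is a set $T$ with a partially defined multiplication $(s,t)\mapsto st\in T$ (defined on a set $T^{(2)}$ of pairs) such that for all $s,t,u\in T$, $(st)u$ is defined (i.e. $st$ is defined and then $(st)u$ is defined) if and only if $s(tu)$ is defined, in which case both are equal. A $k$-semigraph is a semimultiplicative set $T$ with a map $d:T\to\mathbb{N}_0^k$ (the degree) such that (1) $d(xy)=d(x)+d(y)$ whenever $xy$ is defined; (2) for all $x\in T$ and $n_1,n_2\in\mathbb{N}_0^k$ with $d(x)=n_1+n_2$ there are unique $x_1,x_2\in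 T$ with $x=x_1x_2$, $d(x_1)=n_1$, $d(x_2)=n_2$. $T^{(\min)}(x,y)=\{(\alpha,\beta)\in T\times T: x\alpha, y\beta \text{ are defined},\ x\alpha=y\beta,\ d(x\alpha)=d(x)\vee d(y)\}$; $T$ is finitely aligned if all these sets are finite. $T$ is a non-unital $k$-semigraph if $T=T_1\setminus\{1\}$ for a $k$-semigraph $T_1$ with unit $1$; it is called finitely aligned if $T_1$ is. Semigraph algebra. A ($k$-)semigraph algebra $X$ is a $*$-algebra generated by disjoint subsets $\mathcal{P},\mathcal{T}\subseteq X$ such that: (i) $\mathcal{P}$ is a set of commuting projections closed under multiplication; (ii) $\mathcal{T}$ is a set of nonzero partial isometries closed under nonzero products; (iii) $\mathcal{T}$ is a non-unital finitely aligned $k$-semigraph (the product of $s,t\in\mathcal{T}$ is defined in $\mathcal{T}$ iff $st\ne0$ in $X$, and is then $st$), with unitization $\mathcal{T}_1=\mathcal{T}\sqcup\{1\}$, where $1$ is identified with the unit of the unitization $X\oplus\mathbb{C}1$; (iv) for all $x\in\mathcal{T}$, $p\in\mathcal{P}$ there is $q\in\mathcal{P}$ with $px=xq$; (v) for all $x,y\in\mathcal{T}$ there are $q_{x,y,\alpha,\beta}\in\mathcal{P}$ with $x^*y=\sum_{(\alpha,\beta)\in\mathcal{T}_1^{(\min)}(x,y)}\alpha\, q_{x,y,\alpha,\beta}\,\beta^*$; (vi) $X$ is canonically the quotient of $\mathbb{F}$ by a subset of the fiber space of $\mathbb{F}$, i.e. the kernel of the canonical map $\mathbb{F}\to X$ is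 generated, as a two-sided self-adjoint ideal, by a subset of the fiber space. Here $\mathbb{F}$ is the free non-unital $*$-algebra on the letter set $\mathcal{T}\cup\mathcal{P}$ (with basis all nonempty formal words in letters $a$ and $a^*$); the degree $d(x_1\cdots x_n)=\sum_i d(x_i)\in\mathbb{Z}^k$ of a word is given by the semigraph degree on $\mathcal{T}$, $d(p)=0$ for $p\in\mathcal{P}$, $d(a^* )=-d(a)$; $\mathbb{F}_n$ is the span of words of degree $n$; the fiber space of $\mathbb{F}$ is $\bigcup_{n\in\mathbb{Z}^k}\mathbb{F}_n$. The fiber space of $X$ is the image of the fiber space of $\mathbb{F}$ under the canonical map $\mathbb{F}\to X$. *)

theory Defs
  imports Complex_Main "HOL-Library.Poly_Mapping"
begin

section \<open>Star-algebras over the complex numbers\<close>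

text \<open>The algebras are not assumed to have a unit, and may be zero.\<close>

class complex_star_algebra = ring +
  fixes scaleC :: "complex \<Rightarrow> 'a \<Rightarrow> 'a"  (infixr "*\<^sub>C" 75)
    and adj :: "'a \<Rightarrow> 'a"  ("_\<^sup>\<star>" [1000] 999)
  assumes scaleC_add_right: "a *\<^sub>C (x + y) = a *\<^sub>C x + a *\<^sub>C y"
    and scaleC_add_left: "(a + b) *\<^sub>C x = a *\<^sub>C x + b *\<^sub>C x"
    and scaleC_scaleC: "a *\<^sub>C (b *\<^sub>C x) = (a * b) *\<^sub>C x"
    and scaleC_one: "1 *\<^sub>C x = x"
    and mult_scaleC_left: "(a *\<^sub>C x) * y = a *\<^sub>C (x * y)"
    and mult_scaleC_right: "x * (a *\<^sub>C y) = a *\<^sub>C (x * y)"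
    and adj_adj: "(x\<^sup>\<star>)\<^sup>\<star> = x"
    and adj_add: "(x + y)\<^sup>\<star> = x\<^sup>\<star> + y\<^sup>\<star>"
    and adj_mult: "(x * y)\<^sup>\<star> = y\<^sup>\<star> * x\<^sup>\<star>"
    and adj_scaleC: "(a *\<^sub>C x)\<^sup>\<star> = cnj a *\<^sub>C x\<^sup>\<star>"

definition is_projection :: "'a::complex_star_algebra \<Rightarrow> bool" where
  "is_projection p \<longleftrightarrow> p = p * p \<and> p = p\<^sup>\<star>"

definition is_partial_isometry :: "'a::complex_star_algebra \<Rightarrow> bool" where
  "is_partial_isometry s \<longleftrightarrow> s * s\<^sup>\<star> * s = s"

definition is_star_subalgebra :: "'a::complex_star_algebra set \<Rightarrow> bool" where
  "is_star_subalgebra A \<longleftrightarrow>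
     0 \<in> A \<and> (\<forall>x\<in>A. \<forall>y\<in>A. x + y \<in> A \<and> x * y \<in> A) \<and>
     (\<forall>c. \<forall>x\<in>A. c *\<^sub>C x \<in> A) \<and> (\<forall>x\<in>A. x\<^sup>\<star> \<in> A)"

text \<open>Two-sided self-adjoint ideals of a star-subalgebra \<open>A\<close>. The explicit \<open>A\<close> is needed for the
  free algebra on a set of letters, which sits inside the free algebra on all elements of a type.\<close>

definition is_star_ideal :: "'a::complex_star_algebra set \<Rightarrow> 'a set \<Rightarrow> bool" where
  "is_star_ideal A I \<longleftrightarrow>
     I \<subseteq> A \<and> 0 \<in> I \<and> (\<forall>x\<in>I. \<forall>y\<in>I. x + y \<in> I) \<and> (\<forall>c. \<forall>x\<in>I. c *\<^sub>C x \<in> I) \<and>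
     (\<forall>a\<in>A. \<forall>x\<in>I. a * x \<in> I \<and> x * a \<in> I) \<and> (\<forall>x\<in>I. x\<^sup>\<star> \<in> I)"

definition star_ideal_generated :: "'a::complex_star_algebra set \<Rightarrow> 'a set \<Rightarrow> 'a set" where
  "star_ideal_generated A S = is_star_ideal A hull S"

definition is_star_hom :: "('a::complex_star_algebra \<Rightarrow> 'b::complex_star_algebra) \<Rightarrow> bool" where
  "is_star_hom f \<longleftrightarrow>
     (\<forall>x y. f (x + y) = f x + f y) \<and> (\<forall>x y. f (x * y) = f x * f y) \<and>
     (\<forall>c x. f (c *\<^sub>C x) = c *\<^sub>C f x) \<and> (\<forall>x. f (x\<^sup>\<star>) = (f x)\<^sup>\<star>)"

text \<open>\<open>f\<close> exhibits its codomain as the quotient of its domain by the two-sided self-adjoint ideal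
  generated by \<open>S\<close>. The quotient is a type of its own and thus determined up to the canonical
  isomorphism with the algebra of cosets.\<close>

definition is_quotient_map ::
    "('a::complex_star_algebra \<Rightarrow> 'b::complex_star_algebra) \<Rightarrow> 'a set \<Rightarrow> bool" where
  "is_quotient_map f S \<longleftrightarrow>
     is_star_hom f \<and> surj f \<and> {x. f x = 0} = star_ideal_generated UNIV S"


section \<open>Free non-unital star-algebras\<close>

datatype 'a letter = Gen (base: 'a) | Adj (base: 'a)

primrec flip_letter :: "'a letter \<Rightarrow> 'a letter" where
  "flip_letter (Gen a) = Adj a"
| "flip_letter (Adj a) = Gen a"

definition adj_word :: "'a letter list \<Rightarrow> 'a letter list" where
  "adj_word w = rev (map flip_letter w)"

lemma flip_flip_letter [simp]: "flip_letter (flip_letter l) = l"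
  by (cases l) simp_all

lemma adj_word_adj_word [simp]: "adj_word (adj_word w) = w"
  by (simp add: adj_word_def rev_map comp_def)

lemma adj_word_Nil [simp]: "adj_word [] = []"
  by (simp add: adj_word_def)

lemma length_adj_word [simp]: "length (adj_word w) = length w"
  by (simp add: adj_word_def)

text \<open>An element is a finitely supported family of coefficients of nonempty words; multiplication
  extends concatenation of words bilinearly.\<close>

typedef 'a free_star_algebra =
  "{\<phi> :: 'a letter list \<Rightarrow> complex. finite {w. \<phi> w \<noteq> 0} \<and> \<phi> [] = 0}"
  morphisms word_coeff Abs_free_star_algebra
  by (rule exI[of _ "\<lambda>_. 0"]) simp

setup_lifting type_definition_free_star_algebra

instantiation free_star_algebra :: (type) complex_star_algebra
begin

lift_definition zero_free_star_algebra :: "'a free_star_algebra" is "\<lambda>_. 0"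
  by simp

lift_definition plus_free_star_algebra ::
    "'a free_star_algebra \<Rightarrow> 'a free_star_algebra \<Rightarrow> 'a free_star_algebra"
  is "\<lambda>\<phi> \<psi> w. \<phi> w + \<psi> w"
proof (intro conjI CollectI; (elim CollectE conjE)?)
  fix \<phi> \<psi> :: "'a letter list \<Rightarrow> complex"
  assume "finite {w. \<phi> w \<noteq> 0}" "finite {w. \<psi> w \<noteq> 0}"
  then have "finite ({w. \<phi> w \<noteq> 0} \<union> {w. \<psi> w \<noteq> 0})" by simp
  then show "finite {w. \<phi> w + \<psi> w \<noteq> 0}" by (rule rev_finite_subset) auto
qed simp

lift_definition minus_free_star_algebra ::
    "'a free_star_algebra \<Rightarrow> 'a free_star_algebra \<Rightarrow> 'a free_star_algebra"
  is "\<lambda>\<phi> \<psi> w. \<phi> w - \<psi> w"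
proof (intro conjI CollectI; (elim CollectE conjE)?)
  fix \<phi> \<psi> :: "'a letter list \<Rightarrow> complex"
  assume "finite {w. \<phi> w \<noteq> 0}" "finite {w. \<psi> w \<noteq> 0}"
  then have "finite ({w. \<phi> w \<noteq> 0} \<union> {w. \<psi> w \<noteq> 0})" by simp
  then show "finite {w. \<phi> w - \<psi> w \<noteq> 0}" by (rule rev_finite_subset) auto
qed simp

lift_definition uminus_free_star_algebra :: "'a free_star_algebra \<Rightarrow> 'a free_star_algebra"
  is "\<lambda>\<phi> w. - \<phi> w"
  by simp

lift_definition times_free_star_algebra ::
    "'a free_star_algebra \<Rightarrow> 'a free_star_algebra \<Rightarrow> 'a free_star_algebra"
  is "\<lambda>\<phi> \<psi> w. \<Sum>i\<le>length w. \<phi> (take i w) * \<psi> (drop i w)"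
proof (intro conjI CollectI; (elim CollectE conjE)?)
  fix \<phi> \<psi> :: "'a letter list \<Rightarrow> complex"
  assume fin: "finite {w. \<phi> w \<noteq> 0}" "finite {w. \<psi> w \<noteq> 0}"
  have "{w. (\<Sum>i\<le>length w. \<phi> (take i w) * \<psi> (drop i w)) \<noteq> 0}
    \<subseteq> (\<lambda>(u, v). u @ v) ` ({w. \<phi> w \<noteq> 0} \<times> {w. \<psi> w \<noteq> 0})"
  proof
    fix w assume "w \<in> {w. (\<Sum>i\<le>length w. \<phi> (take i w) * \<psi> (drop i w)) \<noteq> 0}"
    then obtain i where "\<phi> (take i w) * \<psi> (drop i w) \<noteq> 0"
      by (metis (mono_tags, lifting) mem_Collect_eq sum.neutral)
    then show "w \<in> (\<lambda>(u, v). u @ v) ` ({w. \<phi> w \<noteq> 0} \<times> {w. \<psi> w \<noteq> 0})"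
      by (intro image_eqI[of _ _ "(take i w, drop i w)"]) auto
  qed
  then show "finite {w. (\<Sum>i\<le>length w. \<phi> (take i w) * \<psi> (drop i w)) \<noteq> 0}"
    using fin by (meson finite_SigmaI finite_imageI finite_subset)
qed simp

lift_definition scaleC_free_star_algebra ::
    "complex \<Rightarrow> 'a free_star_algebra \<Rightarrow> 'a free_star_algebra"
  is "\<lambda>c \<phi> w. c * \<phi> w"
  by (auto elim!: rev_finite_subset)

lift_definition adj_free_star_algebra :: "'a free_star_algebra \<Rightarrow> 'a free_star_algebra"
  is "\<lambda>\<phi> w. cnj (\<phi> (adj_word w))"
proof (intro conjI CollectI; elim CollectE conjE)
  fix \<phi> :: "'a letter list \<Rightarrow> complex"
  assume "finite {w. \<phi> w \<noteq> 0}"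
  moreover have "{w. cnj (\<phi> (adj_word w)) \<noteq> 0} \<subseteq> adj_word ` {w. \<phi> w \<noteq> 0}"
    by (auto intro!: image_eqI[of _ adj_word "adj_word _"])
  ultimately show "finite {w. cnj (\<phi> (adj_word w)) \<noteq> 0}"
    by (meson finite_imageI finite_subset)
qed simp

instance
proof
  fix a b c :: "'a free_star_algebra" and r s :: complex
  show "a * b * c = a * (b * c)"
  proof (transfer, rule ext)
    fix \<phi> \<psi> \<chi> :: "'a letter list \<Rightarrow> complex" and w :: "'a letter list"
    let ?n = "length w"
    let ?f = "\<lambda>i j. \<phi> (take i w) * \<psi> (drop i (take j w)) * \<chi> (drop j w)"
    have "(\<Sum>j\<le>?n. (\<Sum>i\<le>length (take j w). \<phi> (take i (take j w)) * \<psi> (drop i (take j w))) *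
            \<chi> (drop j w))
        = (\<Sum>j\<le>?n. \<Sum>i\<le>j. ?f i j)"
      by (auto simp: sum_distrib_right min_def intro!: sum.cong)
    also have "\<dots> = (\<Sum>(j, i) \<in> (SIGMA j:{..?n}. {..j}). ?f i j)"
      by (rule sum.Sigma) auto
    also have "\<dots> = (\<Sum>(i, k) \<in> (SIGMA i:{..?n}. {..?n - i}). ?f i (i + k))"
      by (rule sum.reindex_bij_witness[of _ "\<lambda>(i, k). (i + k, i)" "\<lambda>(j, i). (i, j - i)"]) auto
    also have "\<dots> = (\<Sum>i\<le>?n. \<Sum>k\<le>?n - i. ?f i (i + k))"
      by (rule sum.Sigma[symmetric]) auto
    also have "\<dots> = (\<Sum>j\<le>?n. \<phi> (take j w) *
        (\<Sum>i\<le>length (drop j w). \<psi> (take i (drop j w)) * \<chi> (drop i (drop j w))))"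
      by (auto simp: sum_distrib_left mult.assoc add.commute drop_take intro!: sum.cong)
    finally show "(\<Sum>j\<le>?n. (\<Sum>i\<le>length (take j w). \<phi> (take i (take j w)) *
          \<psi> (drop i (take j w))) * \<chi> (drop j w)) = (\<Sum>j\<le>?n. \<phi> (take j w) *
        (\<Sum>i\<le>length (drop j w). \<psi> (take i (drop j w)) * \<chi> (drop i (drop j w))))" .
  qed
  show "a + b + c = a + (b + c)" by transfer (simp add: add.assoc)
  show "a + b = b + a" by transfer (simp add: add.commute)
  show "0 + a = a" by transfer simp
  show "- a + a = 0" by transfer simp
  show "a - b = a + - b" by transfer simp
  show "(a + b) * c = a * c + b * c"
    by transfer (simp add: distrib_right sum.distrib)
  show "a * (b + c) = a * b + a * c"
    by transfer (simp add: distrib_left sum.distrib)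
  show "r *\<^sub>C (a + b) = r *\<^sub>C a + r *\<^sub>C b" by transfer (simp add: distrib_left)
  show "(r + s) *\<^sub>C a = r *\<^sub>C a + s *\<^sub>C a" by transfer (simp add: distrib_right)
  show "r *\<^sub>C (s *\<^sub>C a) = (r * s) *\<^sub>C a" by transfer (simp add: mult.assoc)
  show "1 *\<^sub>C a = a" by transfer simp
  show "(r *\<^sub>C a) * b = r *\<^sub>C (a * b)"
    by transfer (simp add: sum_distrib_left mult.assoc)
  show "a * (r *\<^sub>C b) = r *\<^sub>C (a * b)"
    by transfer (simp add: sum_distrib_left algebra_simps)
  show "(a\<^sup>\<star>)\<^sup>\<star> = a" by transfer simp
  show "(a + b)\<^sup>\<star> = a\<^sup>\<star> + b\<^sup>\<star>" by transfer simp
  show "(r *\<^sub>C a)\<^sup>\<star> = cnj r *\<^sub>C a\<^sup>\<star>" by transfer simp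
  show "(a * b)\<^sup>\<star> = b\<^sup>\<star> * a\<^sup>\<star>"
  proof (transfer, rule ext)
    fix \<phi> \<psi> :: "'a letter list \<Rightarrow> complex" and w :: "'a letter list"
    have "(\<Sum>i\<le>length w. cnj (\<phi> (take i (adj_word w))) * cnj (\<psi> (drop i (adj_word w))))
      = (\<Sum>i\<le>length w. cnj (\<psi> (adj_word (take i w))) * cnj (\<phi> (adj_word (drop i w))))"
      by (rule sum.reindex_bij_witness[of _ "\<lambda>i. length w - i" "\<lambda>i. length w - i"])
         (auto simp: adj_word_def take_rev drop_rev drop_map take_map mult.commute)
    then show "cnj (\<Sum>i\<le>length (adj_word w). \<phi> (take i (adj_word w)) * \<psi> (drop i (adj_word w)))
      = (\<Sum>i\<le>length w. cnj (\<psi> (adj_word (take i w))) * cnj (\<phi> (adj_word (drop i w))))"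
      by simp
  qed
qed

end

definition words_over :: "'a set \<Rightarrow> 'a letter list set" where
  "words_over L = {w. w \<noteq> [] \<and> base ` set w \<subseteq> L}"

definition free_on :: "'a set \<Rightarrow> 'a free_star_algebra set" where
  "free_on L = {\<phi>. \<forall>w. word_coeff \<phi> w \<noteq> 0 \<longrightarrow> w \<in> words_over L}"

primrec letter_val :: "'a::complex_star_algebra letter \<Rightarrow> 'a" where
  "letter_val (Gen a) = a"
| "letter_val (Adj a) = a\<^sup>\<star>"

text \<open>The value at the empty word is a dummy; that word never occurs with nonzero coefficient.\<close>

fun word_val :: "'a::complex_star_algebra letter list \<Rightarrow> 'a" where
  "word_val [] = 0"
| "word_val [l] = letter_val l"
| "word_val (l # l' # w) = letter_val l * word_val (l' # w)"

definition canonical_map :: "'a::complex_star_algebra free_star_algebra \<Rightarrow> 'a" where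
  "canonical_map \<phi> = (\<Sum>w | word_coeff \<phi> w \<noteq> 0. word_coeff \<phi> w *\<^sub>C word_val w)"


section \<open>Semigraphs\<close>

text \<open>A partially defined multiplication is a function into an option type, with \<open>None\<close>
  meaning undefined; the index set of the degree is the type \<open>'k\<close>.\<close>

definition semimultiplicative :: "'t set \<Rightarrow> ('t \<Rightarrow> 't \<Rightarrow> 't option) \<Rightarrow> bool" where
  "semimultiplicative T m \<longleftrightarrow>
     (\<forall>s\<in>T. \<forall>t\<in>T. \<forall>x. m s t = Some x \<longrightarrow> x \<in> T) \<and>
     (\<forall>s\<in>T. \<forall>t\<in>T. \<forall>u\<in>T.
        Option.bind (m s t) (\<lambda>x. m x u) = Option.bind (m t u) (\<lambda>y. m s y))"

definition semigraph ::
    "'t set \<Rightarrow> ('t \<Rightarrow> 't \<Rightarrow> 't option) \<Rightarrow> ('t \<Rightarrow> 'k \<Rightarrow>\<^sub>0 nat) \<Rightarrow> bool" where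
  "semigraph T m d \<longleftrightarrow>
     semimultiplicative T m \<and>
     (\<forall>x\<in>T. \<forall>y\<in>T. \<forall>z. m x y = Some z \<longrightarrow> d z = d x + d y) \<and>
     (\<forall>x\<in>T. \<forall>n1 n2. d x = n1 + n2 \<longrightarrow>
        (\<exists>!p. p \<in> T \<times> T \<and> m (fst p) (snd p) = Some x \<and> d (fst p) = n1 \<and> d (snd p) = n2))"

text \<open>The order on \<open>'k \<Rightarrow>\<^sub>0 nat\<close> in the library is not the coordinatewise one, so
  the maximum of two degrees is spelled out.\<close>

definition min_extensions ::
    "'t set \<Rightarrow> ('t \<Rightarrow> 't \<Rightarrow> 't option) \<Rightarrow> ('t \<Rightarrow> 'k \<Rightarrow>\<^sub>0 nat) \<Rightarrow> 't \<Rightarrow> 't \<Rightarrow> ('t \<times> 't) set" where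
  "min_extensions T m d x y =
     {(\<alpha>, \<beta>). \<alpha> \<in> T \<and> \<beta> \<in> T \<and>
        (\<exists>z. m x \<alpha> = Some z \<and> m y \<beta> = Some z \<and>
          (\<forall>i. Poly_Mapping.lookup (d z) i
             = max (Poly_Mapping.lookup (d x) i) (Poly_Mapping.lookup (d y) i)))}"

definition finitely_aligned ::
    "'t set \<Rightarrow> ('t \<Rightarrow> 't \<Rightarrow> 't option) \<Rightarrow> ('t \<Rightarrow> 'k \<Rightarrow>\<^sub>0 nat) \<Rightarrow> bool" where
  "finitely_aligned T m d \<longleftrightarrow> (\<forall>x\<in>T. \<forall>y\<in>T. finite (min_extensions T m d x y))"

text \<open>The unitization adjoins \<open>None\<close> as the unit to \<open>T\<close>. In a semigraph with unit, the unit is the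
  only element of degree \<open>0\<close> and no product of other elements equals it; so any semigraph \<open>T\<^sub>1\<close> with
  unit \<open>1\<close> and \<open>T = T\<^sub>1 - {1}\<close> is of this form.\<close>

definition unitization :: "'t set \<Rightarrow> 't option set" where
  "unitization T = insert None (Some ` T)"

fun unitization_mult ::
    "('t \<Rightarrow> 't \<Rightarrow> 't option) \<Rightarrow> 't option \<Rightarrow> 't option \<Rightarrow> 't option option" where
  "unitization_mult m None y = Some y"
| "unitization_mult m (Some s) None = Some (Some s)"
| "unitization_mult m (Some s) (Some t) = map_option Some (m s t)"

fun unitization_deg :: "('t \<Rightarrow> 'k \<Rightarrow>\<^sub>0 nat) \<Rightarrow> 't option \<Rightarrow> 'k \<Rightarrow>\<^sub>0 nat" where
  "unitization_deg d None = 0"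
| "unitization_deg d (Some t) = d t"

definition nonunital_semigraph ::
    "'t set \<Rightarrow> ('t \<Rightarrow> 't \<Rightarrow> 't option) \<Rightarrow> ('t \<Rightarrow> 'k \<Rightarrow>\<^sub>0 nat) \<Rightarrow> bool" where
  "nonunital_semigraph T m d \<longleftrightarrow>
     semigraph (unitization T) (unitization_mult m) (unitization_deg d)"

definition nonunital_finitely_aligned ::
    "'t set \<Rightarrow> ('t \<Rightarrow> 't \<Rightarrow> 't option) \<Rightarrow> ('t \<Rightarrow> 'k \<Rightarrow>\<^sub>0 nat) \<Rightarrow> bool" where
  "nonunital_finitely_aligned T m d \<longleftrightarrow>
     finitely_aligned (unitization T) (unitization_mult m) (unitization_deg d)"


section \<open>Semigraph algebras\<close>

definition nonzero_mult :: "'a::complex_star_algebra \<Rightarrow> 'a \<Rightarrow> 'a option" where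
  "nonzero_mult s t = (if s * t \<noteq> 0 then Some (s * t) else None)"

text \<open>The element \<open>\<alpha> q \<beta>\<^sup>\<star>\<close> for \<open>\<alpha>, \<beta>\<close> in the unitization, where \<open>None\<close> is the unit adjoined to the
  algebra.\<close>

fun sandwich :: "'a::complex_star_algebra option \<Rightarrow> 'a \<Rightarrow> 'a option \<Rightarrow> 'a" where
  "sandwich None q None = q"
| "sandwich None q (Some b) = q * b\<^sup>\<star>"
| "sandwich (Some a) q None = a * q"
| "sandwich (Some a) q (Some b) = a * q * b\<^sup>\<star>"

context
  fixes P T :: "'a set"
    and d :: "'a \<Rightarrow> 'k \<Rightarrow>\<^sub>0 nat"
begin

text \<open>\<open>P\<close> and \<open>T\<close> are disjoint in all applications.\<close>

definition gen_deg :: "'a \<Rightarrow> 'k \<Rightarrow>\<^sub>0 int" where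
  "gen_deg a = (if a \<in> T then Poly_Mapping.map int (d a) else 0)"

primrec letter_deg :: "'a letter \<Rightarrow> 'k \<Rightarrow>\<^sub>0 int" where
  "letter_deg (Gen a) = gen_deg a"
| "letter_deg (Adj a) = - gen_deg a"

definition word_deg :: "'a letter list \<Rightarrow> 'k \<Rightarrow>\<^sub>0 int" where
  "word_deg w = sum_list (map letter_deg w)"

definition free_fiber :: "('k \<Rightarrow>\<^sub>0 int) \<Rightarrow> 'a free_star_algebra set" where
  "free_fiber n = {\<phi> \<in> free_on (T \<union> P). \<forall>w. word_coeff \<phi> w \<noteq> 0 \<longrightarrow> word_deg w = n}"

definition free_fiber_space :: "'a free_star_algebra set" where
  "free_fiber_space = (\<Union>n. free_fiber n)"

end

definition fiber_space ::
    "'a::complex_star_algebra set \<Rightarrow> 'a set \<Rightarrow> ('a \<Rightarrow> 'k \<Rightarrow>\<^sub>0 nat) \<Rightarrow> 'a set" where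
  "fiber_space P T d = canonical_map ` free_fiber_space P T d"

text \<open>The algebra \<open>X\<close> is the whole type \<open>'a\<close>. The degree map \<open>d\<close> matters on \<open>T\<close> only.\<close>

locale semigraph_algebra =
  fixes P T :: "'a::complex_star_algebra set"
    and d :: "'a \<Rightarrow> 'k \<Rightarrow>\<^sub>0 nat"
  assumes disjoint: "P \<inter> T = {}"
    and generated: "is_star_subalgebra hull (P \<union> T) = UNIV"
    and projections: "p \<in> P \<Longrightarrow> is_projection p"
    and P_commute: "p \<in> P \<Longrightarrow> q \<in> P \<Longrightarrow> p * q = q * p"
    and P_mult_closed: "p \<in> P \<Longrightarrow> q \<in> P \<Longrightarrow> p * q \<in> P"
    and T_nonzero: "0 \<notin> T"
    and partial_isometries: "t \<in> T \<Longrightarrow> is_partial_isometry t"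
    and T_mult_closed: "s \<in> T \<Longrightarrow> t \<in> T \<Longrightarrow> s * t \<noteq> 0 \<Longrightarrow> s * t \<in> T"
    and T_semigraph: "nonunital_semigraph T nonzero_mult d"
    and T_finitely_aligned: "nonunital_finitely_aligned T nonzero_mult d"
    and P_T_exchange: "x \<in> T \<Longrightarrow> p \<in> P \<Longrightarrow> \<exists>q\<in>P. p * x = x * q"
    and adj_mult_expansion: "x \<in> T \<Longrightarrow> y \<in> T \<Longrightarrow>
      \<exists>q. (\<forall>(\<alpha>, \<beta>) \<in> min_extensions (unitization T) (unitization_mult nonzero_mult)
                (unitization_deg d) (Some x) (Some y). q \<alpha> \<beta> \<in> P) \<and>
        x\<^sup>\<star> * y = (\<Sum>(\<alpha>, \<beta>) \<in> min_extensions (unitization T) (unitization_mult nonzero_mult)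
                (unitization_deg d) (Some x) (Some y). sandwich \<alpha> (q \<alpha> \<beta>) \<beta>)"
    and fiber_relations: "\<exists>R \<subseteq> free_fiber_space P T d.
      {\<phi> \<in> free_on (T \<union> P). canonical_map \<phi> = 0} = star_ideal_generated (free_on (T \<union> P)) R"

end

theory Submission imports Defs begin

text \<open>Everything rests on a grading. The relations of \<open>X\<close> are generated by homogeneous elements of the
  free algebra, so the grading of the free algebra by degrees of words descends to \<open>X\<close>
  (\<open>fiber_grading\<close>), and, the relations \<open>S\<close> being homogeneous again, from \<open>X\<close> to \<open>Y\<close>; both steps are
  \<open>quotient_grading\<close>. In \<open>Y\<close> a nonzero element has at most one degree.

  Degrees separate the generators. Elements of \<open>T\<close> have nonzero degree, so \<open>f(P)\<close> and
  \<open>f(T) - {0}\<close> are disjoint. If \<open>f(s) = f(t) \<noteq> 0\<close>, then \<open>s\<close> and \<open>t\<close> have the same degree, and the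
  expansion of \<open>s\<^sup>\<star> t\<close> over minimal common extensions is empty unless \<open>s = t\<close>. So \<open>s \<noteq> t\<close> would give
  \<open>f(s)\<^sup>\<star> f(s) = 0\<close> and \<open>f(s) = 0\<close>. Hence \<open>f\<close> is injective on the elements of \<open>T\<close> that it does not
  kill (\<open>inj_on_survivors\<close>), and the degree carries over to \<open>f(T) - {0}\<close>.

  The surviving elements contain the factors of each of their members, and that is all it takes for
  the semigraph axioms and the minimal common extensions to restrict to them. The restricted extensions
  are those \<open>(\<alpha>, \<beta>)\<close> of \<open>x\<close> and \<open>y\<close> for which \<open>f(x \<alpha>) \<noteq> 0\<close>. The expansion of \<open>x\<^sup>\<star> y\<close> in \<open>X\<close> may
  have further terms, for which it is not evident that their images vanish. But \<open>x\<^sup>\<star> x\<close> belongs to \<open>P\<close>, and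
  absorbing it into the coefficients makes each term divisible by \<open>x \<alpha>\<close>
  (\<open>adj_mult_expansion_normalized\<close>), so that these terms do vanish in \<open>Y\<close>.

  Finally, the generators of \<open>Y\<close> are homogeneous, so the new canonical map respects degrees, its
  kernel is a graded ideal, and such an ideal is generated by its homogeneous elements
  (\<open>fiber_relations_of_homogeneous_generators\<close>).\<close>


section \<open>Linear algebra in star-algebras\<close>

lemma scaleC_zero_left: "0 *\<^sub>C x = (0::'a::complex_star_algebra)"
  using scaleC_add_left[of 0 0 x] by simp

lemma scaleC_zero_right: "c *\<^sub>C 0 = (0::'a::complex_star_algebra)"
  using scaleC_add_right[of c 0 0] by simp

lemma scaleC_minus_one: "(- 1) *\<^sub>C x = - (x::'a::complex_star_algebra)"
  using scaleC_add_left[of 1 "- 1" x]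
  by (simp add: scaleC_zero_left scaleC_one eq_neg_iff_add_eq_0 add.commute)

lemma adj_zero: "0\<^sup>\<star> = (0::'a::complex_star_algebra)"
  using adj_add[of "0::'a" 0] by simp

lemma adj_sum: "(\<Sum>i\<in>I. g i)\<^sup>\<star> = (\<Sum>i\<in>I. (g i)\<^sup>\<star> :: 'a::complex_star_algebra)"
  by (induction I rule: infinite_finite_induct) (simp_all add: adj_zero adj_add)

lemma scaleC_sum_right: "c *\<^sub>C (\<Sum>i\<in>I. g i) = (\<Sum>i\<in>I. c *\<^sub>C g i :: 'a::complex_star_algebra)"
  by (induction I rule: infinite_finite_induct) (simp_all add: scaleC_zero_right scaleC_add_right)

lemma scaleC_sum_left: "(\<Sum>i\<in>I. c i) *\<^sub>C x = (\<Sum>i\<in>I. c i *\<^sub>C x :: 'a::complex_star_algebra)"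
  by (induction I rule: infinite_finite_induct) (simp_all add: scaleC_zero_left scaleC_add_left)

lemma star_hom_simps:
  assumes "is_star_hom f"
  shows "f (x + y) = f x + f y" "f (x * y) = f x * f y" "f (c *\<^sub>C x) = c *\<^sub>C f x"
    "f (x\<^sup>\<star>) = (f x)\<^sup>\<star>"
  using assms by (simp_all add: is_star_hom_def)

lemma star_hom_zero:
  assumes "is_star_hom f"
  shows "f 0 = 0"
  using star_hom_simps(1)[OF assms, of 0 0] by simp

lemma star_hom_sum:
  assumes "is_star_hom f"
  shows "f (\<Sum>i\<in>I. g i) = (\<Sum>i\<in>I. f (g i))"
  by (induction I rule: infinite_finite_induct)
     (simp_all add: star_hom_zero[OF assms] star_hom_simps(1)[OF assms])


section \<open>Graded star-algebras and their homogeneous quotients\<close>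

definition is_subspace :: "'a::complex_star_algebra set \<Rightarrow> bool" where
  "is_subspace W \<longleftrightarrow> 0 \<in> W \<and> (\<forall>x\<in>W. \<forall>y\<in>W. x + y \<in> W) \<and> (\<forall>c. \<forall>x\<in>W. c *\<^sub>C x \<in> W)"

definition homogeneous_sums :: "('g \<Rightarrow> 'a::complex_star_algebra set) \<Rightarrow> 'a set" where
  "homogeneous_sums W = {x. \<exists>N y. finite N \<and> (\<forall>n\<in>N. y n \<in> W n) \<and> x = (\<Sum>n\<in>N. y n)}"

lemma homogeneous_sumsE:
  assumes "x \<in> homogeneous_sums W"
  obtains N y where "finite N" "\<And>n. n \<in> N \<Longrightarrow> y n \<in> W n" "x = (\<Sum>n\<in>N. y n)"
  using assms by (auto simp: homogeneous_sums_def)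

lemma homogeneous_sumsI:
  assumes "finite N" "\<And>n. n \<in> N \<Longrightarrow> y n \<in> W n"
  shows "(\<Sum>n\<in>N. y n) \<in> homogeneous_sums W"
  using assms by (auto simp: homogeneous_sums_def)

lemma homogeneous_sums_member: "x \<in> W n \<Longrightarrow> x \<in> homogeneous_sums W"
  using homogeneous_sumsI[of "{n}" "\<lambda>_. x" W] by simp

lemma homogeneous_sums_zero: "0 \<in> homogeneous_sums W"
  using homogeneous_sumsI[of "{}" _ W] by simp

lemma homogeneous_sums_add:
  assumes W: "\<And>n. is_subspace (W n)"
    and "x \<in> homogeneous_sums W" "x' \<in> homogeneous_sums W"
  shows "x + x' \<in> homogeneous_sums W"
proof -
  obtain N y where N: "finite N" "\<And>n. n \<in> N \<Longrightarrow> y n \<in> W n" "x = (\<Sum>n\<in>N. y n)"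
    using assms(2) by (rule homogeneous_sumsE) blast
  obtain N' y' where N': "finite N'" "\<And>n. n \<in> N' \<Longrightarrow> y' n \<in> W n" "x' = (\<Sum>n\<in>N'. y' n)"
    using assms(3) by (rule homogeneous_sumsE) blast
  let ?z = "\<lambda>n. (if n \<in> N then y n else 0) + (if n \<in> N' then y' n else 0)"
  have "x = (\<Sum>n\<in>N \<union> N'. if n \<in> N then y n else 0)"
    unfolding N(3) using N(1) N'(1) by (intro sum.mono_neutral_cong_left) auto
  moreover have "x' = (\<Sum>n\<in>N \<union> N'. if n \<in> N' then y' n else 0)"
    unfolding N'(3) using N(1) N'(1) by (intro sum.mono_neutral_cong_left) auto
  ultimately have "x + x' = (\<Sum>n\<in>N \<union> N'. ?z n)"
    by (simp only: sum.distrib)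
  moreover have "?z n \<in> W n" for n
    using W[of n] N(2)[of n] N'(2)[of n] unfolding is_subspace_def by simp
  ultimately show ?thesis
    using homogeneous_sumsI[of "N \<union> N'" ?z W] N(1) N'(1) by simp
qed

lemma homogeneous_sums_sum:
  assumes "\<And>n. is_subspace (W n)" "\<And>i. i \<in> I \<Longrightarrow> g i \<in> homogeneous_sums W"
  shows "(\<Sum>i\<in>I. g i) \<in> homogeneous_sums W"
  using assms(2)
  by (induction I rule: infinite_finite_induct)
     (auto intro: homogeneous_sums_zero homogeneous_sums_add[OF assms(1)])

lemma homogeneous_sums_mult:
  assumes W: "\<And>n. is_subspace (W n)"
    and VU: "\<And>m n x y. x \<in> V m \<Longrightarrow> y \<in> U n \<Longrightarrow> x * y \<in> W (m + n)"
    and "x \<in> homogeneous_sums V" "y \<in> homogeneous_sums U"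
  shows "x * y \<in> homogeneous_sums (W :: 'g::plus \<Rightarrow> _)"
proof -
  obtain N u where N: "\<And>n. n \<in> N \<Longrightarrow> u n \<in> V n" "x = (\<Sum>n\<in>N. u n)"
    using assms(3) by (rule homogeneous_sumsE) blast
  obtain M v where M: "\<And>n. n \<in> M \<Longrightarrow> v n \<in> U n" "y = (\<Sum>n\<in>M. v n)"
    using assms(4) by (rule homogeneous_sumsE) blast
  have "u n * v m \<in> homogeneous_sums W" if "n \<in> N" "m \<in> M" for n m
    by (rule homogeneous_sums_member[of _ W "n + m"]) (simp add: VU N(1) M(1) that)
  moreover have "x * y = (\<Sum>n\<in>N. \<Sum>m\<in>M. u n * v m)"
    by (simp add: N(2) M(2) sum_product)
  ultimately have "x * y \<in> homogeneous_sums W"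
    by (simp add: homogeneous_sums_sum[OF W])
  then show ?thesis .
qed

lemma choose_preimages:
  assumes "\<And>n. n \<in> N \<Longrightarrow> y n \<in> f ` V n"
  shows "\<exists>z. \<forall>n\<in>N. z n \<in> V n \<and> f (z n) = y n"
proof (rule bchoice, rule ballI)
  fix n assume "n \<in> N"
  from assms[OF this] show "\<exists>z. z \<in> V n \<and> f z = y n"
    by (auto elim!: imageE)
qed

text \<open>The graded algebra is a subset \<open>A\<close> of its type because the free algebra on \<open>T\<close> and \<open>P\<close> is only a
  subalgebra of the free algebra on all elements of \<open>X\<close>.\<close>

locale star_grading =
  fixes A :: "'a::complex_star_algebra set"
    and V :: "'g::ab_group_add \<Rightarrow> 'a set"
  assumes subspace: "\<And>n. is_subspace (V n)"
    and mult_homogeneous: "\<And>x y m n. x \<in> V m \<Longrightarrow> y \<in> V n \<Longrightarrow> x * y \<in> V (m + n)"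
    and adj_homogeneous: "\<And>x n. x \<in> V n \<Longrightarrow> x\<^sup>\<star> \<in> V (- n)"
    and spanning: "A = homogeneous_sums V"
    and independent: "\<And>N y n. finite N \<Longrightarrow> (\<And>n. n \<in> N \<Longrightarrow> y n \<in> V n) \<Longrightarrow> (\<Sum>n\<in>N. y n) = 0 \<Longrightarrow> n \<in> N
      \<Longrightarrow> y n = 0"
begin

lemma scale_homogeneous: "x \<in> V n \<Longrightarrow> c *\<^sub>C x \<in> V n"
  using subspace[of n] by (simp add: is_subspace_def)

lemma diff_homogeneous: "x \<in> V n \<Longrightarrow> y \<in> V n \<Longrightarrow> x - y \<in> V n"
  using subspace[of n] scale_homogeneous[of y n "- 1"]
  unfolding is_subspace_def scaleC_minus_one by (metis add_uminus_conv_diff)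

lemma zero_homogeneous: "0 \<in> V n"
  using subspace[of n] by (simp add: is_subspace_def)

lemma sum_homogeneous: "(\<And>i. i \<in> I \<Longrightarrow> g i \<in> V n) \<Longrightarrow> (\<Sum>i\<in>I. g i) \<in> V n"
  using subspace[of n] unfolding is_subspace_def
  by (induction I rule: infinite_finite_induct) auto

lemma degree_unique:
  assumes "x \<in> V m" "x \<in> V n" "x \<noteq> 0"
  shows "m = n"
proof (rule ccontr)
  assume "m \<noteq> n"
  let ?y = "\<lambda>k. if k = m then x else 0 - x"
  have "(\<Sum>k\<in>{m, n}. ?y k) = 0"
    using \<open>m \<noteq> n\<close> by simp
  moreover have "?y k \<in> V k" if "k \<in> {m, n}" for k
    using that assms diff_homogeneous[OF zero_homogeneous] by auto
  ultimately have "?y m = 0"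
    by (intro independent[of "{m, n}" ?y m]) simp_all
  with assms(3) show False by simp
qed

text \<open>If the kernel of \<open>f\<close> is generated by homogeneous elements, then it is spanned by
  homogeneous elements: the homogeneous kernel elements already span an ideal. Hence the
  homogeneous components of a kernel element lie in the kernel, which is what independence of the
  images of the homogeneous subspaces amounts to.\<close>

lemma quotient_grading:
  assumes f: "is_star_hom f"
    and ker: "{x \<in> A. f x = 0} = star_ideal_generated A S"
    and S: "S \<subseteq> (\<Union>n. V n)"
  shows "star_grading (f ` A) (\<lambda>n. f ` V n)"
proof
  note hom = star_hom_simps[OF f] star_hom_zero[OF f]
  define W where "W n = {x \<in> V n. f x = 0}" for n
  \<comment> \<open>The sums of homogeneous kernel elements form an ideal that contains \<open>S\<close>, hence the whole kernel.\<close>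
  have W: "is_subspace (W n)" for n
    using subspace[of n] by (auto simp: W_def is_subspace_def hom scaleC_zero_right)
  have W_A: "homogeneous_sums W \<subseteq> A"
    unfolding spanning by (auto simp: homogeneous_sums_def W_def)
  have "is_star_ideal A (homogeneous_sums W)"
    unfolding is_star_ideal_def
  proof (intro conjI ballI allI W_A homogeneous_sums_zero homogeneous_sums_add[of W, OF W])
    fix a x assume ax: "a \<in> A" "x \<in> homogeneous_sums W"
    show "a * x \<in> homogeneous_sums W"
      by (rule homogeneous_sums_mult[of W V W, OF W _ _ ax(2)])
         (use ax(1) spanning in \<open>auto simp: W_def mult_homogeneous hom\<close>)
    show "x * a \<in> homogeneous_sums W"
      by (rule homogeneous_sums_mult[of W W V, OF W _ ax(2)])
         (use ax(1) spanning in \<open>auto simp: W_def mult_homogeneous hom\<close>)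
  next
    fix x assume "x \<in> homogeneous_sums W"
    then obtain N y where N: "\<And>n. n \<in> N \<Longrightarrow> y n \<in> W n" and x: "x = (\<Sum>n\<in>N. y n)"
      by (rule homogeneous_sumsE) blast
    have "(y n)\<^sup>\<star> \<in> W (- n)" if "n \<in> N" for n
      using N[OF that] by (simp add: W_def hom adj_homogeneous adj_zero)
    then have "(y n)\<^sup>\<star> \<in> homogeneous_sums W" if "n \<in> N" for n
      using that homogeneous_sums_member[of _ W] by blast
    then show "x\<^sup>\<star> \<in> homogeneous_sums W"
      unfolding x adj_sum by (intro homogeneous_sums_sum[OF W])
    have "c *\<^sub>C y n \<in> homogeneous_sums W" if "n \<in> N" for c n
      using N[OF that] W[of n] homogeneous_sums_member[of _ W] unfolding is_subspace_def by blast
    then show "c *\<^sub>C x \<in> homogeneous_sums W" for c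
      unfolding x scaleC_sum_right by (intro homogeneous_sums_sum[OF W])
  qed
  moreover have "S \<subseteq> homogeneous_sums W"
  proof
    fix s assume s: "s \<in> S"
    then have "s \<in> star_ideal_generated A S"
      unfolding star_ideal_generated_def by (rule hull_inc)
    then have "f s = 0"
      using ker by blast
    moreover obtain n where "s \<in> V n"
      using s S by blast
    ultimately show "s \<in> homogeneous_sums W"
      by (intro homogeneous_sums_member[of s W n]) (simp add: W_def)
  qed
  ultimately have "star_ideal_generated A S \<subseteq> homogeneous_sums W"
    unfolding star_ideal_generated_def by (intro hull_minimal)
  then have ker_sums: "x \<in> homogeneous_sums W" if "x \<in> A" "f x = 0" for x
    using ker that by blast

  show "is_subspace (f ` V n)" for n
    using subspace[of n] unfolding is_subspace_def
    by (auto simp: hom(1,3)[symmetric] intro!: image_eqI[of 0 f 0] hom(5)[symmetric])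
  show "x * y \<in> f ` V (m + n)" if "x \<in> f ` V m" "y \<in> f ` V n" for x y m n
    using that mult_homogeneous by (force simp: hom(2)[symmetric])
  show "x\<^sup>\<star> \<in> f ` V (- n)" if "x \<in> f ` V n" for x n
    using that adj_homogeneous by (force simp: hom(4)[symmetric])
  show "f ` A = homogeneous_sums (\<lambda>n. f ` V n)"
  proof (intro subset_antisym subsetI)
    fix x assume "x \<in> f ` A"
    then obtain N y where "finite N" "\<And>n. n \<in> N \<Longrightarrow> y n \<in> V n" "x = f (\<Sum>n\<in>N. y n)"
      unfolding spanning by (auto elim!: homogeneous_sumsE)
    then show "x \<in> homogeneous_sums (\<lambda>n. f ` V n)"
      by (auto simp: star_hom_sum[OF f] intro!: homogeneous_sumsI)
  next
    fix x assume "x \<in> homogeneous_sums (\<lambda>n. f ` V n)"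
    then obtain N y where N: "finite N" "\<And>n. n \<in> N \<Longrightarrow> y n \<in> f ` V n" "x = (\<Sum>n\<in>N. y n)"
      by (rule homogeneous_sumsE) blast
    obtain z where z: "\<And>n. n \<in> N \<Longrightarrow> z n \<in> V n \<and> f (z n) = y n"
      using choose_preimages[of N y f V] N(2) by blast
    have "x = f (\<Sum>n\<in>N. z n)"
      using z by (simp add: N(3) star_hom_sum[OF f])
    moreover have "(\<Sum>n\<in>N. z n) \<in> A"
      unfolding spanning using z N(1) by (intro homogeneous_sumsI) auto
    ultimately show "x \<in> f ` A" by blast
  qed
  fix N y n
  assume N: "finite N" "\<And>n. n \<in> N \<Longrightarrow> y n \<in> f ` V n" "(\<Sum>n\<in>N. y n) = 0" and n: "n \<in> N"
  obtain z where z: "\<And>n. n \<in> N \<Longrightarrow> z n \<in> V n \<and> f (z n) = y n"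
    using choose_preimages[of N y f V] N(2) by blast
  have "(\<Sum>n\<in>N. z n) \<in> A"
    unfolding spanning using z N(1) by (intro homogeneous_sumsI) auto
  moreover have "f (\<Sum>n\<in>N. z n) = 0"
    using z N(3) by (simp add: star_hom_sum[OF f])
  ultimately have "(\<Sum>n\<in>N. z n) \<in> homogeneous_sums W"
    by (rule ker_sums)
  then obtain M w where M: "finite M" "\<And>n. n \<in> M \<Longrightarrow> w n \<in> W n"
      "(\<Sum>n\<in>N. z n) = (\<Sum>n\<in>M. w n)"
    by (rule homogeneous_sumsE) blast
  \<comment> \<open>By independence in \<open>A\<close>, the two decompositions of the same kernel element agree.\<close>
  let ?v = "\<lambda>n. (if n \<in> N then z n else 0) - (if n \<in> M then w n else 0)"
  have "(\<Sum>n\<in>N. z n) = (\<Sum>n\<in>N \<union> M. if n \<in> N then z n else 0)"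
    using N(1) M(1) by (intro sum.mono_neutral_cong_left) auto
  moreover have "(\<Sum>n\<in>M. w n) = (\<Sum>n\<in>N \<union> M. if n \<in> M then w n else 0)"
    using N(1) M(1) by (intro sum.mono_neutral_cong_left) auto
  ultimately have "(\<Sum>n\<in>N \<union> M. ?v n) = 0"
    unfolding sum_subtractf using M(3) by simp
  moreover have "?v k \<in> V k" for k
    using z[of k] M(2)[of k] by (intro diff_homogeneous) (auto simp: W_def zero_homogeneous)
  ultimately have "?v n = 0"
    using N(1) M(1) n by (intro independent[of "N \<union> M" ?v n]) auto
  then have "z n = (if n \<in> M then w n else 0)"
    using n by simp
  then have "f (z n) = 0"
    using M(2)[of n] by (auto simp: W_def hom)
  then show "y n = 0"
    using z n by simp
qed

end


section \<open>The free star-algebra\<close>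

lemma word_coeff_zero: "word_coeff 0 w = 0"
  by transfer simp

lemma word_coeff_add: "word_coeff (x + y) w = word_coeff x w + word_coeff y w"
  by transfer simp

lemma word_coeff_scaleC: "word_coeff (c *\<^sub>C x) w = c * word_coeff x w"
  by transfer simp

lemma word_coeff_adj: "word_coeff (x\<^sup>\<star>) w = cnj (word_coeff x (adj_word w))"
  by transfer simp

lemma word_coeff_mult:
  "word_coeff (x * y) w = (\<Sum>i\<le>length w. word_coeff x (take i w) * word_coeff y (drop i w))"
  by transfer simp

lemma word_coeff_Nil: "word_coeff x [] = 0"
  using word_coeff[of x] by simp

lemma finite_word_coeff: "finite {w. word_coeff x w \<noteq> 0}"
  using word_coeff[of x] by simp

lemma word_coeff_sum: "word_coeff (\<Sum>i\<in>I. g i) w = (\<Sum>i\<in>I. word_coeff (g i) w)"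
  by (induction I rule: infinite_finite_induct) (simp_all add: word_coeff_zero word_coeff_add)

lemma free_star_algebra_eqI: "(\<And>w. word_coeff x w = word_coeff y w) \<Longrightarrow> x = y"
  by (metis ext word_coeff_inject)

lemma word_coeff_mult_nonzeroE:
  assumes "word_coeff (x * y) w \<noteq> 0"
  obtains u v where "w = u @ v" "word_coeff x u \<noteq> 0" "word_coeff y v \<noteq> 0"
proof -
  obtain i where "word_coeff x (take i w) * word_coeff y (drop i w) \<noteq> 0"
    using assms unfolding word_coeff_mult by (meson sum.not_neutral_contains_not_neutral)
  then show ?thesis
    using that[of "take i w" "drop i w"] by simp
qed

lemma word_coeff_add_nonzeroE:
  assumes "word_coeff (x + y) w \<noteq> 0"
  obtains "word_coeff x w \<noteq> 0" | "word_coeff y w \<noteq> 0"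
  using assms by (force simp: word_coeff_add)

lemma letter_val_flip: "letter_val (flip_letter l) = (letter_val l)\<^sup>\<star>"
  by (cases l) (simp_all add: adj_adj)

lemma word_val_Cons: "w \<noteq> [] \<Longrightarrow> word_val (l # w) = letter_val l * word_val w"
  by (cases w) simp_all

lemma word_val_append: "u \<noteq> [] \<Longrightarrow> v \<noteq> [] \<Longrightarrow> word_val (u @ v) = word_val u * word_val v"
proof (induction u)
  case (Cons l u)
  then show ?case
    by (cases "u = []") (simp_all add: word_val_Cons mult.assoc)
qed simp

lemma word_val_adj: "word_val (adj_word w) = (word_val w)\<^sup>\<star>"
proof (induction w)
  case Nil
  show ?case by (simp add: adj_zero)
next
  case (Cons l w)
  have "adj_word (l # w) = adj_word w @ [flip_letter l]"
    by (simp add: adj_word_def)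
  moreover have "adj_word w \<noteq> []" if "w \<noteq> []"
    using that by (simp add: adj_word_def)
  ultimately show ?case
    using Cons by (cases "w = []") (simp_all add: word_val_append word_val_Cons letter_val_flip adj_mult)
qed

lemma canonical_map_superset:
  assumes "finite W" "{w. word_coeff x w \<noteq> 0} \<subseteq> W"
  shows "canonical_map x = (\<Sum>w\<in>W. word_coeff x w *\<^sub>C word_val w)"
  unfolding canonical_map_def using assms
  by (intro sum.mono_neutral_left) (auto simp: scaleC_zero_left)

text \<open>Each side is a sum over pairs of words. On the left the pairs are grouped by their concatenation,
  since the coefficient of \<open>w\<close> in a product ranges over the ways to cut \<open>w\<close> in two.\<close>

lemma canonical_map_mult: "canonical_map (x * y) = canonical_map x * canonical_map y"
proof -
  define A where "A = {w. word_coeff x w \<noteq> 0}"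
  define B where "B = {w. word_coeff y w \<noteq> 0}"
  define W where "W = (\<lambda>(u, v). u @ v) ` (A \<times> B)"
  have fin: "finite A" "finite B" "finite W"
    by (simp_all add: A_def B_def W_def finite_word_coeff)
  have supp: "{w. word_coeff (x * y) w \<noteq> 0} \<subseteq> W"
    by (auto simp: W_def A_def B_def elim!: word_coeff_mult_nonzeroE)
  have conv: "word_coeff (x * y) w
      = (\<Sum>(u, v)\<in>{p \<in> A \<times> B. (\<lambda>(u, v). u @ v) p = w}. word_coeff x u * word_coeff y v)" for w
  proof -
    have "word_coeff (x * y) w = (\<Sum>(u, v)\<in>(\<lambda>i. (take i w, drop i w)) ` {..length w}.
        word_coeff x u * word_coeff y v)"
      unfolding word_coeff_mult
      by (subst sum.reindex) (auto simp: inj_on_def dest!: arg_cong[where f = length])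
    also have "\<dots> = (\<Sum>(u, v)\<in>{p \<in> A \<times> B. (\<lambda>(u, v). u @ v) p = w}. word_coeff x u * word_coeff y v)"
    proof (rule sum.mono_neutral_right)
      show "{p \<in> A \<times> B. (\<lambda>(u, v). u @ v) p = w} \<subseteq> (\<lambda>i. (take i w, drop i w)) ` {..length w}"
      proof
        fix p assume "p \<in> {p \<in> A \<times> B. (\<lambda>(u, v). u @ v) p = w}"
        then obtain u v where "p = (u, v)" "w = u @ v" by auto
        then show "p \<in> (\<lambda>i. (take i w, drop i w)) ` {..length w}"
          by (intro image_eqI[of _ _ "length u"]) auto
      qed
    qed (auto simp: A_def B_def)
    finally show ?thesis .
  qed
  have "canonical_map (x * y) = (\<Sum>w\<in>W. \<Sum>p\<in>{p \<in> A \<times> B. (\<lambda>(u, v). u @ v) p = w}.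
      (word_coeff x (fst p) * word_coeff y (snd p)) *\<^sub>C word_val (fst p @ snd p))"
    unfolding canonical_map_superset[OF fin(3) supp] conv scaleC_sum_left
    by (intro sum.cong refl) auto
  also have "\<dots> = (\<Sum>p\<in>A \<times> B.
      (word_coeff x (fst p) * word_coeff y (snd p)) *\<^sub>C word_val (fst p @ snd p))"
    using fin by (intro sum.group) (auto simp: W_def)
  also have "\<dots> = (\<Sum>p\<in>A \<times> B.
      (word_coeff x (fst p) *\<^sub>C word_val (fst p)) * (word_coeff y (snd p) *\<^sub>C word_val (snd p)))"
  proof (intro sum.cong refl)
    fix p assume "p \<in> A \<times> B"
    then have "fst p \<noteq> []" "snd p \<noteq> []"
      using word_coeff_Nil[of x] word_coeff_Nil[of y] by (auto simp: A_def B_def)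
    then show "(word_coeff x (fst p) * word_coeff y (snd p)) *\<^sub>C word_val (fst p @ snd p)
      = (word_coeff x (fst p) *\<^sub>C word_val (fst p)) * (word_coeff y (snd p) *\<^sub>C word_val (snd p))"
      by (simp add: word_val_append mult_scaleC_left mult_scaleC_right scaleC_scaleC mult.commute)
  qed
  also have "\<dots> = canonical_map x * canonical_map y"
    unfolding canonical_map_def A_def[symmetric] B_def[symmetric] sum_product sum.cartesian_product
    by (intro sum.cong) auto
  finally show ?thesis .
qed

lemma canonical_map_hom: "is_star_hom canonical_map"
  unfolding is_star_hom_def
proof (intro conjI allI)
  fix x y :: "'a free_star_algebra" and c
  let ?W = "{w. word_coeff x w \<noteq> 0} \<union> {w. word_coeff y w \<noteq> 0}"
  have W: "finite ?W" by (simp add: finite_word_coeff)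
  have "canonical_map x = (\<Sum>w\<in>?W. word_coeff x w *\<^sub>C word_val w)"
    "canonical_map y = (\<Sum>w\<in>?W. word_coeff y w *\<^sub>C word_val w)"
    "canonical_map (x + y) = (\<Sum>w\<in>?W. word_coeff (x + y) w *\<^sub>C word_val w)"
    using W by (intro canonical_map_superset; auto simp: word_coeff_add)+
  then show "canonical_map (x + y) = canonical_map x + canonical_map y"
    by (simp add: word_coeff_add scaleC_add_left sum.distrib)
  have "canonical_map (c *\<^sub>C x) = (\<Sum>w | word_coeff x w \<noteq> 0. word_coeff (c *\<^sub>C x) w *\<^sub>C word_val w)"
    by (intro canonical_map_superset) (auto simp: finite_word_coeff word_coeff_scaleC)
  then show "canonical_map (c *\<^sub>C x) = c *\<^sub>C canonical_map x"
    by (simp add: canonical_map_def scaleC_sum_right word_coeff_scaleC scaleC_scaleC)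
  have "canonical_map (x\<^sup>\<star>) = (\<Sum>w | word_coeff x w \<noteq> 0. cnj (word_coeff x w) *\<^sub>C word_val (adj_word w))"
    unfolding canonical_map_def
    by (rule sum.reindex_bij_witness[of _ adj_word adj_word]) (simp_all add: word_coeff_adj)
  then show "canonical_map (x\<^sup>\<star>) = (canonical_map x)\<^sup>\<star>"
    by (simp add: canonical_map_def adj_sum adj_scaleC word_val_adj)
qed (rule canonical_map_mult)

lemma words_over_append: "u \<in> words_over L \<Longrightarrow> v \<in> words_over L \<Longrightarrow> u @ v \<in> words_over L"
  by (auto simp: words_over_def)

lemma base_flip_letter [simp]: "base (flip_letter l) = base l"
  by (cases l) simp_all

lemma words_over_adj_word: "adj_word w \<in> words_over L \<longleftrightarrow> w \<in> words_over L"
  by (auto simp: words_over_def adj_word_def image_image)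

lemma free_on_star_subalgebra: "is_star_subalgebra (free_on L)"
  unfolding is_star_subalgebra_def
proof (intro conjI ballI allI)
  fix x y assume "x \<in> free_on L" "y \<in> free_on L"
  then show "x * y \<in> free_on L" "x + y \<in> free_on L"
    by (auto simp: free_on_def words_over_append
        elim!: word_coeff_mult_nonzeroE word_coeff_add_nonzeroE)
next
  fix x c assume "x \<in> free_on L"
  then show "c *\<^sub>C x \<in> free_on L" "x\<^sup>\<star> \<in> free_on L"
    using words_over_adj_word[of _ L]
    by (auto simp: free_on_def word_coeff_scaleC word_coeff_adj)
qed (simp add: free_on_def word_coeff_zero)

lift_definition free_generator :: "'a \<Rightarrow> 'a free_star_algebra" is "\<lambda>a w. if w = [Gen a] then 1 else 0"
  by simp

lemma free_generator_in_free_on: "a \<in> L \<Longrightarrow> free_generator a \<in> free_on L"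
  unfolding free_on_def by (auto simp: free_generator.rep_eq words_over_def split: if_splits)

lemma canonical_map_free_generator: "canonical_map (free_generator a) = a"
  by (subst canonical_map_superset[of "{[Gen a]}"]) (auto simp: free_generator.rep_eq scaleC_one)

lemma star_hom_image_subalgebra:
  assumes f: "is_star_hom f" and A: "is_star_subalgebra A"
  shows "is_star_subalgebra (f ` A)"
  using A unfolding is_star_subalgebra_def
  by (auto simp: star_hom_simps[OF f, symmetric] intro!: image_eqI[of 0 f 0] star_hom_zero[OF f, symmetric])

lemma canonical_map_onto_generated:
  assumes "is_star_subalgebra hull L = UNIV"
  shows "canonical_map ` free_on L = (UNIV :: 'a::complex_star_algebra set)"
proof -
  have "L \<subseteq> canonical_map ` free_on L"
    by (metis canonical_map_free_generator free_generator_in_free_on image_eqI subsetI)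
  then have "is_star_subalgebra hull L \<subseteq> canonical_map ` free_on L"
    by (intro hull_minimal star_hom_image_subalgebra canonical_map_hom free_on_star_subalgebra)
  with assms show ?thesis by blast
qed

lift_definition word_component :: "('a letter list \<Rightarrow> bool) \<Rightarrow> 'a free_star_algebra \<Rightarrow> 'a free_star_algebra"
  is "\<lambda>Q \<phi> w. if Q w then \<phi> w else 0"
  by (auto elim!: rev_finite_subset)

lemma word_deg_append: "word_deg T d (u @ v) = word_deg T d u + word_deg T d v"
  by (simp add: word_deg_def)

lemma word_deg_adj_word: "word_deg T d (adj_word w) = - word_deg T d w"
proof (induction w)
  case (Cons l w)
  have "letter_deg T d (flip_letter l) = - letter_deg T d l"
    by (cases l) simp_all
  with Cons show ?case
    by (simp add: word_deg_def adj_word_def)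
qed (simp add: word_deg_def)

lemma free_star_grading: "star_grading (free_on (T \<union> P)) (free_fiber P T d)"
proof
  fix n
  show "is_subspace (free_fiber P T d n)"
    using free_on_star_subalgebra[of "T \<union> P"]
    by (auto simp: is_subspace_def free_fiber_def is_star_subalgebra_def word_coeff_zero
        word_coeff_scaleC elim!: word_coeff_add_nonzeroE)
next
  fix x y m n assume "x \<in> free_fiber P T d m" "y \<in> free_fiber P T d n"
  then show "x * y \<in> free_fiber P T d (m + n)"
    using free_on_star_subalgebra[of "T \<union> P"]
    by (auto simp: free_fiber_def is_star_subalgebra_def word_deg_append elim!: word_coeff_mult_nonzeroE)
next
  fix x n assume x: "x \<in> free_fiber P T d n"
  show "x\<^sup>\<star> \<in> free_fiber P T d (- n)"
    unfolding free_fiber_def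
  proof (clarify, intro conjI allI impI)
    show "x\<^sup>\<star> \<in> free_on (T \<union> P)"
      using x free_on_star_subalgebra[of "T \<union> P"] by (auto simp: free_fiber_def is_star_subalgebra_def)
    fix w assume "word_coeff (x\<^sup>\<star>) w \<noteq> 0"
    then have "word_deg T d (adj_word w) = n"
      using x by (auto simp: free_fiber_def word_coeff_adj)
    then show "word_deg T d w = - n"
      by (metis word_deg_adj_word minus_minus)
  qed
next
  show "free_on (T \<union> P) = homogeneous_sums (free_fiber P T d)"
  proof (intro subset_antisym subsetI)
    fix x assume x: "x \<in> free_on (T \<union> P)"
    let ?N = "word_deg T d ` {w. word_coeff x w \<noteq> 0}"
    have N: "finite ?N" by (simp add: finite_word_coeff)
    let ?y = "\<lambda>n. word_component (\<lambda>w. word_deg T d w = n) x"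
    have "x = (\<Sum>n\<in>?N. ?y n)"
    proof (rule free_star_algebra_eqI)
      fix w
      have "word_coeff (\<Sum>n\<in>?N. ?y n) w = (\<Sum>n\<in>?N. if word_deg T d w = n then word_coeff x w else 0)"
        unfolding word_coeff_sum by (simp add: word_component.rep_eq)
      also have "\<dots> = word_coeff x w"
        using N by (auto simp: sum.delta)
      finally show "word_coeff x w = word_coeff (\<Sum>n\<in>?N. ?y n) w" ..
    qed
    also have "\<dots> \<in> homogeneous_sums (free_fiber P T d)"
      using N x by (intro homogeneous_sumsI)
        (auto simp: free_fiber_def free_on_def word_component.rep_eq split: if_splits)
    finally show "x \<in> homogeneous_sums (free_fiber P T d)" .
  next
    fix x assume "x \<in> homogeneous_sums (free_fiber P T d)"
    then obtain N y where N: "\<And>n. n \<in> N \<Longrightarrow> y n \<in> free_fiber P T d n" "x = (\<Sum>n\<in>N. y n)"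
      by (rule homogeneous_sumsE) blast
    show "x \<in> free_on (T \<union> P)"
      unfolding N(2) free_on_def
    proof (clarify)
      fix w assume "word_coeff (\<Sum>n\<in>N. y n) w \<noteq> 0"
      then obtain n where "n \<in> N" "word_coeff (y n) w \<noteq> 0"
        unfolding word_coeff_sum by (meson sum.not_neutral_contains_not_neutral)
      then show "w \<in> words_over (T \<union> P)"
        using N(1)[of n] by (auto simp: free_fiber_def free_on_def)
    qed
  qed
next
  fix N y n
  assume N: "finite N" "\<And>n. n \<in> N \<Longrightarrow> y n \<in> free_fiber P T d n" "(\<Sum>n\<in>N. y n) = 0" and n: "n \<in> N"
  show "y n = 0"
  proof (rule free_star_algebra_eqI)
    fix w
    show "word_coeff (y n) w = word_coeff 0 w"
    proof (cases "word_coeff (y n) w = 0")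
      case False
      then have deg: "word_deg T d w = n"
        using N(2)[OF n] by (auto simp: free_fiber_def)
      have "(\<Sum>m\<in>N. word_coeff (y m) w) = (\<Sum>m\<in>N. if m = n then word_coeff (y m) w else 0)"
        using N(2) deg by (intro sum.cong) (auto simp: free_fiber_def)
      also have "\<dots> = word_coeff (y n) w"
        using N(1) n by simp
      finally show ?thesis
        using N(3) by (metis word_coeff_sum)
    qed (simp add: word_coeff_zero)
  qed
qed

text \<open>Because the generators are homogeneous, the canonical map respects degrees. So the homogeneous
  components of a relation have values of different degrees that add up to zero, and are therefore
  relations themselves.\<close>

lemma fiber_relations_of_homogeneous_generators:
  fixes d :: "'a::complex_star_algebra \<Rightarrow> 'k \<Rightarrow>\<^sub>0 nat"
  assumes grading: "star_grading A V"
    and disj: "P \<inter> T = {}"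
    and P: "\<And>p. p \<in> P \<Longrightarrow> p \<in> V 0"
    and T: "\<And>t. t \<in> T \<Longrightarrow> t \<in> V (Poly_Mapping.map int (d t))"
  shows "\<exists>R \<subseteq> free_fiber_space P T d.
      {\<phi> \<in> free_on (T \<union> P). canonical_map \<phi> = 0} = star_ideal_generated (free_on (T \<union> P)) R"
proof (intro exI conjI)
  let ?F = "free_on (T \<union> P)"
  let ?K = "{\<phi> \<in> ?F. canonical_map \<phi> = 0}"
  let ?R = "{\<phi> \<in> free_fiber_space P T d. canonical_map \<phi> = 0}"
  note hom = star_hom_simps[OF canonical_map_hom] star_hom_zero[OF canonical_map_hom]
  interpret star_grading A V
    by (rule grading)
  interpret F: star_grading ?F "free_fiber P T d"
    by (rule free_star_grading)
  have letter: "letter_val l \<in> V (letter_deg T d l)" if "base l \<in> T \<union> P" for l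
    using that disj P T adj_homogeneous[OF P] adj_homogeneous[OF T]
    by (cases l) (auto simp: gen_deg_def)
  have word: "word_val w \<in> V (word_deg T d w)" if "w \<in> words_over (T \<union> P)" for w
    using that
  proof (induction w rule: word_val.induct)
    case (3 l l' w)
    then have "letter_val l * word_val (l' # w) \<in> V (letter_deg T d l + word_deg T d (l' # w))"
      by (intro mult_homogeneous letter) (auto simp: words_over_def)
    then show ?case by (simp add: word_deg_def)
  qed (use letter in \<open>auto simp: words_over_def word_deg_def\<close>)
  have canonical: "canonical_map \<phi> \<in> V n" if "\<phi> \<in> free_fiber P T d n" for \<phi> n
    unfolding canonical_map_def
  proof (intro sum_homogeneous scale_homogeneous)
    fix w assume "w \<in> {w. word_coeff \<phi> w \<noteq> 0}"
    with that word[of w] show "word_val w \<in> V n"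
      by (auto simp: free_fiber_def free_on_def)
  qed
  show "?R \<subseteq> free_fiber_space P T d" by blast
  show "?K = star_ideal_generated ?F ?R"
  proof
    have "is_star_ideal ?F ?K"
      using free_on_star_subalgebra[of "T \<union> P"]
      by (auto simp: is_star_ideal_def is_star_subalgebra_def hom scaleC_zero_right adj_zero)
    moreover have "?R \<subseteq> ?K"
      by (auto simp: free_fiber_space_def free_fiber_def)
    ultimately show "star_ideal_generated ?F ?R \<subseteq> ?K"
      unfolding star_ideal_generated_def by (intro hull_minimal)
    show "?K \<subseteq> star_ideal_generated ?F ?R"
      unfolding star_ideal_generated_def hull_def
    proof (intro subsetI InterI)
      fix \<phi> I assume \<phi>: "\<phi> \<in> ?K" and I: "I \<in> {I. is_star_ideal ?F I \<and> ?R \<subseteq> I}"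
      from \<phi> have "\<phi> \<in> homogeneous_sums (free_fiber P T d)"
        using F.spanning by blast
      then obtain N y where N: "finite N" "\<And>n. n \<in> N \<Longrightarrow> y n \<in> free_fiber P T d n"
          "\<phi> = (\<Sum>n\<in>N. y n)"
        by (rule homogeneous_sumsE) blast
      have "(\<Sum>n\<in>N. canonical_map (y n)) = 0"
        using \<phi> by (simp add: N(3) star_hom_sum[OF canonical_map_hom])
      then have "canonical_map (y n) = 0" if "n \<in> N" for n
        using independent[OF N(1), of "\<lambda>n. canonical_map (y n)"] N(2) canonical that by blast
      then have "y n \<in> I" if "n \<in> N" for n
        using I N(2)[OF that] that by (auto simp: free_fiber_space_def)
      with \<open>finite N\<close> have "(\<Sum>n\<in>N. y n) \<in> I"
        using I unfolding is_star_ideal_def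
        by (induction N rule: finite_induct) auto
      then show "\<phi> \<in> I" by (simp add: N(3))
    qed
  qed
qed

lemma lookup_map_int: "Poly_Mapping.lookup (Poly_Mapping.map int n) i = int (Poly_Mapping.lookup n i)"
  by (simp add: Poly_Mapping.map.rep_eq when_def)

lemma map_int_eq_iff: "Poly_Mapping.map int m = Poly_Mapping.map int n \<longleftrightarrow> m = n"
  by (metis lookup_map_int of_nat_eq_iff poly_mapping_eqI)


section \<open>Restricting a semigraph to a subset closed under factors\<close>

text \<open>\<open>U'\<close> is a subset of a semigraph \<open>U\<close> in which products that leave \<open>U'\<close> become undefined; \<open>e\<close> is an
  isomorphism onto a copy of this structure. In the application \<open>U'\<close> consists of the unit and the
  elements of \<open>T\<close> that the quotient map does not kill, and \<open>e\<close> is the quotient map.\<close>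

locale semigraph_restriction =
  fixes U U' :: "'s set" and m :: "'s \<Rightarrow> 's \<Rightarrow> 's option" and d :: "'s \<Rightarrow> 'k \<Rightarrow>\<^sub>0 nat"
    and e :: "'s \<Rightarrow> 't" and m' :: "'t \<Rightarrow> 't \<Rightarrow> 't option" and d' :: "'t \<Rightarrow> 'k \<Rightarrow>\<^sub>0 nat"
  assumes semigraph: "semigraph U m d"
    and subset: "U' \<subseteq> U"
    and factors: "\<And>a b z. a \<in> U \<Longrightarrow> b \<in> U \<Longrightarrow> m a b = Some z \<Longrightarrow> z \<in> U' \<Longrightarrow> a \<in> U' \<and> b \<in> U'"
    and inj: "inj_on e U'"
    and mult: "\<And>a b. a \<in> U' \<Longrightarrow> b \<in> U' \<Longrightarrow>
      m' (e a) (e b) = Option.bind (m a b) (\<lambda>z. if z \<in> U' then Some (e z) else None)"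
    and deg: "\<And>a. a \<in> U' \<Longrightarrow> d' (e a) = d a"
begin

lemma mult_eq_Some_iff:
  "a \<in> U' \<Longrightarrow> b \<in> U' \<Longrightarrow> m' (e a) (e b) = Some w \<longleftrightarrow> (\<exists>z\<in>U'. m a b = Some z \<and> w = e z)"
  by (auto simp: mult bind_eq_Some_conv)

lemma assoc:
  "s \<in> U \<Longrightarrow> t \<in> U \<Longrightarrow> u \<in> U \<Longrightarrow>
    Option.bind (m s t) (\<lambda>x. m x u) = Option.bind (m t u) (\<lambda>y. m s y)"
  using semigraph unfolding semigraph_def semimultiplicative_def by blast

lemma mult_closed: "s \<in> U \<Longrightarrow> t \<in> U \<Longrightarrow> m s t = Some x \<Longrightarrow> x \<in> U"
  using semigraph unfolding semigraph_def semimultiplicative_def by blast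

text \<open>An inner product that leaves \<open>U'\<close> cannot have an outer product in \<open>U'\<close>. So both ways of
  multiplying three elements amount to multiplying them in \<open>U\<close> and then testing membership in \<open>U'\<close> once.\<close>

lemma semimultiplicative_restriction: "semimultiplicative (e ` U') m'"
  unfolding semimultiplicative_def
proof (intro conjI ballI allI impI)
  fix s' t' x assume "s' \<in> e ` U'" "t' \<in> e ` U'" "m' s' t' = Some x"
  then show "x \<in> e ` U'"
    by (auto simp: mult_eq_Some_iff)
next
  fix s' t' u' assume "s' \<in> e ` U'" "t' \<in> e ` U'" "u' \<in> e ` U'"
  then obtain s t u where stu: "s' = e s" "t' = e t" "u' = e u" "s \<in> U'" "t \<in> U'" "u \<in> U'"
    by blast
  define g where "g = (\<lambda>z. if z \<in> U' then Some (e z) else None)"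
  have g: "g z = None" if "z \<notin> U'" for z
    using that by (simp add: g_def)
  have "Option.bind (m' (e s) (e t)) (\<lambda>x. m' x (e u))
    = Option.bind (Option.bind (m s t) (\<lambda>z. m z u)) g"
  proof (cases "m s t")
    case (Some z)
    then have z: "z \<in> U"
      using mult_closed stu subset by blast
    show ?thesis
    proof (cases "z \<in> U'")
      case True
      then show ?thesis using stu Some by (simp add: mult g_def)
    next
      case False
      then have "g w = None" if "m z u = Some w" for w
        using factors[OF z _ that] stu subset g by blast
      then show ?thesis using stu Some False
        by (cases "m z u") (simp_all add: mult)
    qed
  qed (use stu in \<open>simp add: mult\<close>)
  also have "\<dots> = Option.bind (Option.bind (m t u) (\<lambda>z. m s z)) g"
    using assoc stu subset by (metis subsetD)
  also have "\<dots> = Option.bind (m' (e t) (e u)) (\<lambda>x. m' (e s) x)"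
  proof (cases "m t u")
    case (Some z)
    then have z: "z \<in> U"
      using mult_closed stu subset by blast
    show ?thesis
    proof (cases "z \<in> U'")
      case True
      then show ?thesis using stu Some by (simp add: mult g_def)
    next
      case False
      then have "g w = None" if "m s z = Some w" for w
        using factors[OF _ z that] stu subset g by blast
      then show ?thesis using stu Some False
        by (cases "m s z") (simp_all add: mult)
    qed
  qed (use stu in \<open>simp add: mult\<close>)
  finally show "Option.bind (m' s' t') (\<lambda>x. m' x u') = Option.bind (m' t' u') (\<lambda>y. m' s' y)"
    by (simp add: stu)
qed

text \<open>Closure under factors keeps the factorizations of elements of \<open>U'\<close> inside \<open>U'\<close>.\<close>

lemma semigraph_restricted: "semigraph (e ` U') m' d'"
  unfolding semigraph_def
proof (intro conjI ballI allI impI semimultiplicative_restriction)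
  fix x y z assume "x \<in> e ` U'" "y \<in> e ` U'" "m' x y = Some z"
  then obtain a b c where abc: "x = e a" "y = e b" "z = e c" "a \<in> U'" "b \<in> U'" "c \<in> U'"
      "m a b = Some c"
    by (auto simp: mult_eq_Some_iff)
  then have "d c = d a + d b"
    using semigraph subset unfolding semigraph_def by blast
  with abc show "d' z = d' x + d' y"
    by (simp add: deg)
next
  fix x n1 n2 assume "x \<in> e ` U'" and deg_x: "d' x = n1 + n2"
  then obtain a where a: "x = e a" "a \<in> U'" by blast
  let ?Q = "\<lambda>p. p \<in> U \<times> U \<and> m (fst p) (snd p) = Some a \<and> d (fst p) = n1 \<and> d (snd p) = n2"
  have "a \<in> U" "d a = n1 + n2"
    using a deg_x subset by (auto simp: deg)
  then have "\<exists>!p. ?Q p"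
    using semigraph unfolding semigraph_def by blast
  then obtain p where p: "?Q p" and unique: "\<And>q. ?Q q \<Longrightarrow> q = p"
    by blast
  have p': "fst p \<in> U'" "snd p \<in> U'"
    using p factors[of "fst p" "snd p" a] a by auto
  show "\<exists>!p. p \<in> e ` U' \<times> e ` U' \<and> m' (fst p) (snd p) = Some x \<and> d' (fst p) = n1 \<and> d' (snd p) = n2"
  proof (rule ex1I[of _ "(e (fst p), e (snd p))"])
    show "(e (fst p), e (snd p)) \<in> e ` U' \<times> e ` U' \<and>
        m' (fst (e (fst p), e (snd p))) (snd (e (fst p), e (snd p))) = Some x \<and>
        d' (fst (e (fst p), e (snd p))) = n1 \<and> d' (snd (e (fst p), e (snd p))) = n2"
      using p p' a by (auto simp: mult deg)
  next
    fix q assume q: "q \<in> e ` U' \<times> e ` U' \<and> m' (fst q) (snd q) = Some x \<and> d' (fst q) = n1 \<and> d' (snd q) = n2"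
    then obtain b c where bc: "q = (e b, e c)" "b \<in> U'" "c \<in> U'" by auto
    with q a obtain z where "z \<in> U'" "m b c = Some z" "e a = e z"
      by (auto simp: mult_eq_Some_iff)
    then have "m b c = Some a"
      using inj a by (metis inj_onD)
    then have "(b, c) = p"
      using bc q subset by (intro unique) (auto simp: deg)
    with bc show "q = (e (fst p), e (snd p))" by auto
  qed
qed

lemma min_extensions_restricted:
  assumes "x \<in> U'" "y \<in> U'"
  shows "min_extensions (e ` U') m' d' (e x) (e y) =
    map_prod e e ` {(a, b) \<in> min_extensions U m d x y. \<exists>z\<in>U'. m x a = Some z}"
proof (intro subset_antisym subsetI)
  fix p assume "p \<in> min_extensions (e ` U') m' d' (e x) (e y)"
  then obtain a b z' where ab: "p = (e a, e b)" "a \<in> U'" "b \<in> U'"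
      and z': "m' (e x) (e a) = Some z'" "m' (e y) (e b) = Some z'"
      and max: "\<And>i. Poly_Mapping.lookup (d' z') i
        = max (Poly_Mapping.lookup (d' (e x)) i) (Poly_Mapping.lookup (d' (e y)) i)"
    by (auto simp: min_extensions_def)
  obtain z where z: "z \<in> U'" "m x a = Some z" "z' = e z"
    using z'(1) assms ab by (auto simp: mult_eq_Some_iff)
  moreover have "m y b = Some z"
    using z'(2) assms ab z inj by (auto simp: mult_eq_Some_iff dest: inj_onD)
  ultimately have "(a, b) \<in> min_extensions U m d x y"
    using max ab assms subset by (auto simp: min_extensions_def deg)
  with z ab show "p \<in> map_prod e e ` {(a, b) \<in> min_extensions U m d x y. \<exists>z\<in>U'. m x a = Some z}"
    by (intro image_eqI[of _ _ "(a, b)"]) auto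
next
  fix p assume "p \<in> map_prod e e ` {(a, b) \<in> min_extensions U m d x y. \<exists>z\<in>U'. m x a = Some z}"
  then obtain a b z where p: "p = (e a, e b)" and ab: "a \<in> U" "b \<in> U"
      and z: "z \<in> U'" "m x a = Some z" "m y b = Some z"
      and max: "\<And>i. Poly_Mapping.lookup (d z) i
        = max (Poly_Mapping.lookup (d x) i) (Poly_Mapping.lookup (d y) i)"
    by (auto simp: min_extensions_def)
  have "a \<in> U'" "b \<in> U'"
    using factors[of x a z] factors[of y b z] ab z assms subset by auto
  moreover have "m' (e x) (e a) = Some (e z)" "m' (e y) (e b) = Some (e z)"
    using calculation z assms by (auto simp: mult)
  ultimately show "p \<in> min_extensions (e ` U') m' d' (e x) (e y)"
    using p z max assms by (auto simp: min_extensions_def deg)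
qed

lemma inj_on_min_extensions_restricted:
  assumes "x \<in> U'" "y \<in> U'"
  shows "inj_on (map_prod e e) {(a, b) \<in> min_extensions U m d x y. \<exists>z\<in>U'. m x a = Some z}"
proof (rule inj_on_subset[OF map_prod_inj_on[OF inj inj]], rule subsetI)
  fix p assume "p \<in> {(a, b) \<in> min_extensions U m d x y. \<exists>z\<in>U'. m x a = Some z}"
  then obtain a b z where "p = (a, b)" "a \<in> U" "b \<in> U" "z \<in> U'" "m x a = Some z" "m y b = Some z"
    by (auto simp: min_extensions_def)
  then show "p \<in> U' \<times> U'"
    using factors[of x a z] factors[of y b z] assms subset by auto
qed

end


section \<open>Products of generators in a semigraph algebra\<close>

context semigraph_algebra
begin

abbreviation common_extensions :: "'a \<Rightarrow> 'a \<Rightarrow> ('a option \<times> 'a option) set" where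
  "common_extensions x y \<equiv> min_extensions (unitization T) (unitization_mult nonzero_mult)
     (unitization_deg d) (Some x) (Some y)"

text \<open>An element \<open>t\<close> of degree \<open>0\<close> would have the two factorizations \<open>t 1\<close> and \<open>1 t\<close> into
  factors of degree \<open>0\<close>.\<close>

lemma deg_nonzero:
  assumes "t \<in> T"
  shows "d t \<noteq> 0"
proof
  assume "d t = 0"
  let ?Q = "\<lambda>p. p \<in> unitization T \<times> unitization T \<and>
      unitization_mult nonzero_mult (fst p) (snd p) = Some (Some t) \<and>
      unitization_deg d (fst p) = 0 \<and> unitization_deg d (snd p) = 0"
  have "unitization_deg d (Some t) = 0 + 0" "Some t \<in> unitization T"
    using \<open>d t = 0\<close> assms by (auto simp: unitization_def)
  then have "\<exists>!p. ?Q p"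
    using T_semigraph unfolding nonunital_semigraph_def semigraph_def by blast
  moreover have "?Q (None, Some t)" "?Q (Some t, None)"
    using \<open>d t = 0\<close> assms by (auto simp: unitization_def)
  ultimately have "(None, Some t) = (Some t, None)"
    by blast
  then show False by simp
qed

lemma deg_mult: "s \<in> T \<Longrightarrow> t \<in> T \<Longrightarrow> s * t \<noteq> 0 \<Longrightarrow> d (s * t) = d s + d t"
proof -
  assume st: "s \<in> T" "t \<in> T" "s * t \<noteq> 0"
  have "unitization_mult nonzero_mult (Some s) (Some t) = Some (Some (s * t))"
    using st by (simp add: nonzero_mult_def)
  moreover have "Some s \<in> unitization T" "Some t \<in> unitization T"
    using st by (auto simp: unitization_def)
  ultimately have "unitization_deg d (Some (s * t)) = unitization_deg d (Some s) + unitization_deg d (Some t)"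
    using T_semigraph unfolding nonunital_semigraph_def semigraph_def by blast
  then show ?thesis by simp
qed

lemma common_extensions_cases:
  assumes "(\<alpha>, \<beta>) \<in> common_extensions x y"
  shows "\<alpha> = None \<or> (\<exists>a\<in>T. \<alpha> = Some a)"
  using assms by (auto simp: min_extensions_def unitization_def)

text \<open>A proper extension has strictly larger degree. So elements of equal degree have no common
  extension of that degree, unless they coincide.\<close>

lemma common_extensions_eq_deg:
  assumes "x \<in> T" "y \<in> T" "d x = d y"
  shows "common_extensions x y = (if x = y then {(None, None)} else {})"
proof -
  have unit: "\<alpha> = None \<and> z = Some u"
    if "\<alpha> \<in> unitization T" "u \<in> T" "unitization_mult nonzero_mult (Some u) \<alpha> = Some z"
      "unitization_deg d z = d u" for \<alpha> u z
  proof (cases \<alpha>)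
    case None
    then show ?thesis using that by simp
  next
    case (Some a)
    then have "a \<in> T" "u * a \<noteq> 0" "z = Some (u * a)"
      using that by (auto simp: unitization_def nonzero_mult_def split: if_splits)
    then have "d u + d a = d u"
      using that deg_mult by simp
    then show ?thesis
      using deg_nonzero \<open>a \<in> T\<close> by simp
  qed
  have "\<alpha> = None \<and> \<beta> = None \<and> x = y" if "(\<alpha>, \<beta>) \<in> common_extensions x y" for \<alpha> \<beta>
  proof -
    obtain z where \<alpha>\<beta>: "\<alpha> \<in> unitization T" "\<beta> \<in> unitization T"
      and z: "unitization_mult nonzero_mult (Some x) \<alpha> = Some z"
        "unitization_mult nonzero_mult (Some y) \<beta> = Some z"
      and max: "\<And>i. Poly_Mapping.lookup (unitization_deg d z) i = Poly_Mapping.lookup (d x) i"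
      using \<open>(\<alpha>, \<beta>) \<in> common_extensions x y\<close> assms(3) by (auto simp: min_extensions_def)
    from max have "unitization_deg d z = d x"
      by (rule poly_mapping_eqI)
    then show ?thesis
      using unit[OF \<alpha>\<beta>(1) assms(1) z(1)] unit[OF \<alpha>\<beta>(2) assms(2) z(2)] assms(3) by simp
  qed
  moreover have "(None, None) \<in> common_extensions x x"
    by (auto simp: min_extensions_def unitization_def)
  ultimately show ?thesis
    by (auto split: if_splits)
qed

lemma adj_mult_eq_deg:
  assumes "x \<in> T" "y \<in> T" "d x = d y" "x \<noteq> y"
  shows "x\<^sup>\<star> * y = 0"
proof -
  have "common_extensions x y = {}"
    using common_extensions_eq_deg[OF assms(1-3)] assms(4) by simp
  moreover obtain q where "x\<^sup>\<star> * y = (\<Sum>(\<alpha>, \<beta>)\<in>common_extensions x y. sandwich \<alpha> (q \<alpha> \<beta>) \<beta>)"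
    using adj_mult_expansion[OF assms(1,2)] by blast
  ultimately show ?thesis by simp
qed

lemma source_projection:
  assumes "x \<in> T"
  shows "x\<^sup>\<star> * x \<in> P"
proof -
  have ext: "common_extensions x x = {(None, None)}"
    using common_extensions_eq_deg[OF assms assms] by simp
  obtain q where "\<forall>(\<alpha>, \<beta>)\<in>common_extensions x x. q \<alpha> \<beta> \<in> P"
    and exp: "x\<^sup>\<star> * x = (\<Sum>(\<alpha>, \<beta>)\<in>common_extensions x x. sandwich \<alpha> (q \<alpha> \<beta>) \<beta>)"
    using adj_mult_expansion[OF assms assms] by blast
  then have "q None None \<in> P"
    unfolding ext by simp
  moreover have "x\<^sup>\<star> * x = q None None"
    using exp unfolding ext by simp
  ultimately show ?thesis by simp
qed

lemma source_projection_idem: "x \<in> T \<Longrightarrow> (x\<^sup>\<star> * x) * (x\<^sup>\<star> * x) = x\<^sup>\<star> * x"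
  using partial_isometries[of x] by (simp add: is_partial_isometry_def mult.assoc)

text \<open>The source projection of \<open>x\<close> is a left unit for \<open>x\<^sup>\<star> * y\<close>. Commuting it past the left factors
  \<open>\<alpha>\<close> absorbs it into the projections in the expansion, so that a homomorphism that kills \<open>x * \<alpha>\<close>
  kills the term of \<open>\<alpha>\<close>, even if it kills none of \<open>x\<close>, \<open>\<alpha>\<close>, \<open>\<beta>\<close>.\<close>

lemma adj_mult_expansion_normalized:
  assumes "x \<in> T" "y \<in> T"
  obtains q where
    "\<And>\<alpha> \<beta>. (\<alpha>, \<beta>) \<in> common_extensions x y \<Longrightarrow> q \<alpha> \<beta> \<in> P"
    "\<And>\<alpha> \<beta>. (\<alpha>, \<beta>) \<in> common_extensions x y \<Longrightarrow>
      x\<^sup>\<star> * x * sandwich \<alpha> (q \<alpha> \<beta>) \<beta> = sandwich \<alpha> (q \<alpha> \<beta>) \<beta>"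
    "x\<^sup>\<star> * y = (\<Sum>(\<alpha>, \<beta>)\<in>common_extensions x y. sandwich \<alpha> (q \<alpha> \<beta>) \<beta>)"
proof -
  obtain q where q: "\<And>\<alpha> \<beta>. (\<alpha>, \<beta>) \<in> common_extensions x y \<Longrightarrow> q \<alpha> \<beta> \<in> P"
    and exp: "x\<^sup>\<star> * y = (\<Sum>(\<alpha>, \<beta>)\<in>common_extensions x y. sandwich \<alpha> (q \<alpha> \<beta>) \<beta>)"
    using adj_mult_expansion[OF assms] by blast
  let ?p = "x\<^sup>\<star> * x"
  have p: "?p \<in> P" by (rule source_projection[OF assms(1)])
  have "\<exists>r. r \<in> P \<and> sandwich \<alpha> r \<beta> = ?p * sandwich \<alpha> (q \<alpha> \<beta>) \<beta>"
    if "(\<alpha>, \<beta>) \<in> common_extensions x y" for \<alpha> \<beta>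
  proof (cases \<alpha>)
    case None
    then show ?thesis
      using P_mult_closed[OF p q[OF that]] by (cases \<beta>) (auto simp: mult.assoc)
  next
    case (Some a)
    then have "a \<in> T"
      using common_extensions_cases[OF that] by auto
    then obtain r where r: "r \<in> P" "?p * a = a * r"
      using P_T_exchange p by blast
    have "a * (r * z) = ?p * (a * z)" for z
      using r(2) by (metis mult.assoc)
    then show ?thesis
      using P_mult_closed[OF r(1) q[OF that]] Some by (cases \<beta>) (auto simp: mult.assoc)
  qed
  then obtain r where r: "\<And>\<alpha> \<beta>. (\<alpha>, \<beta>) \<in> common_extensions x y \<Longrightarrow>
      r \<alpha> \<beta> \<in> P \<and> sandwich \<alpha> (r \<alpha> \<beta>) \<beta> = ?p * sandwich \<alpha> (q \<alpha> \<beta>) \<beta>"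
    by metis
  have "x\<^sup>\<star> * y = ?p * (x\<^sup>\<star> * y)"
  proof -
    have "x\<^sup>\<star> * x * x\<^sup>\<star> = (x * x\<^sup>\<star> * x)\<^sup>\<star>"
      by (simp add: adj_mult adj_adj mult.assoc)
    then have "x\<^sup>\<star> * x * x\<^sup>\<star> = x\<^sup>\<star>"
      using partial_isometries[OF assms(1)] by (simp add: is_partial_isometry_def)
    then show ?thesis by (metis mult.assoc)
  qed
  also have "\<dots> = (\<Sum>(\<alpha>, \<beta>)\<in>common_extensions x y. ?p * sandwich \<alpha> (q \<alpha> \<beta>) \<beta>)"
    unfolding exp sum_distrib_left by (intro sum.cong) auto
  also have "\<dots> = (\<Sum>(\<alpha>, \<beta>)\<in>common_extensions x y. sandwich \<alpha> (r \<alpha> \<beta>) \<beta>)"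
    using r by (intro sum.cong) auto
  finally have "x\<^sup>\<star> * y = (\<Sum>(\<alpha>, \<beta>)\<in>common_extensions x y. sandwich \<alpha> (r \<alpha> \<beta>) \<beta>)" .
  moreover have "?p * sandwich \<alpha> (r \<alpha> \<beta>) \<beta> = sandwich \<alpha> (r \<alpha> \<beta>) \<beta>"
    if "(\<alpha>, \<beta>) \<in> common_extensions x y" for \<alpha> \<beta>
    using r[OF that] source_projection_idem[OF assms(1)] by (simp add: mult.assoc[symmetric])
  ultimately show ?thesis
    using that[of r] r by blast
qed

end


section \<open>Images of semigraph algebras in graded algebras\<close>

text \<open>The quotient map, seen as a surjection onto a graded algebra that sends the generators to
  homogeneous elements of the expected degrees.\<close>

locale homogeneous_image = semigraph_algebra P T d
  for P T :: "'a::complex_star_algebra set" and d :: "'a \<Rightarrow> 'k \<Rightarrow>\<^sub>0 nat" +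
  fixes f :: "'a \<Rightarrow> 'b::complex_star_algebra" and V :: "('k \<Rightarrow>\<^sub>0 int) \<Rightarrow> 'b set"
  assumes grading: "star_grading UNIV V"
    and f: "is_star_hom f"
    and surj: "surj f"
    and f_P: "p \<in> P \<Longrightarrow> f p \<in> V 0"
    and f_T: "t \<in> T \<Longrightarrow> f t \<in> V (Poly_Mapping.map int (d t))"
begin

interpretation star_grading UNIV V
  by (rule grading)

lemmas hom = star_hom_simps[OF f]

lemma f_zero: "f 0 = 0"
  by (rule star_hom_zero[OF f])

definition survivors :: "'a set" where
  "survivors = {t \<in> T. f t \<noteq> 0}"

lemma image_survivors: "f ` survivors = f ` T - {0}"
  by (auto simp: survivors_def)

text \<open>Elements of \<open>T\<close> with the same nonzero image have the same degree. If they were different, then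
  their ranges would be orthogonal, and so the common image would be a partial isometry with range
  orthogonal to itself.\<close>

lemma inj_on_survivors: "inj_on f survivors"
proof (rule inj_onI, rule ccontr)
  fix s t assume "s \<in> survivors" "t \<in> survivors" and eq: "f s = f t" and "s \<noteq> t"
  then have st: "s \<in> T" "t \<in> T" "f s \<noteq> 0"
    by (auto simp: survivors_def)
  then have "Poly_Mapping.map int (d s) = Poly_Mapping.map int (d t)"
    using degree_unique[of "f s"] f_T[of s] f_T[of t] eq by auto
  then have "s\<^sup>\<star> * t = 0"
    using st \<open>s \<noteq> t\<close> by (intro adj_mult_eq_deg) (simp_all add: map_int_eq_iff)
  then have "(f s)\<^sup>\<star> * f s = 0"
    using f_zero by (metis eq hom(2,4))
  moreover have "f s = f s * ((f s)\<^sup>\<star> * f s)"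
    using partial_isometries[OF st(1)] unfolding is_partial_isometry_def by (metis hom(2,4) mult.assoc)
  ultimately show False
    using st(3) by simp
qed

text \<open>A common nonzero value would have degree \<open>0\<close> and at the same time the degree of an element of
  \<open>T\<close>.\<close>

lemma images_disjoint: "f ` P \<inter> (f ` T - {0}) = {}"
proof (intro equals0I)
  fix y assume "y \<in> f ` P \<inter> (f ` T - {0})"
  then obtain p t where "p \<in> P" "t \<in> T" "y = f p" "y = f t" "y \<noteq> 0" by auto
  moreover have "Poly_Mapping.map int 0 = (0 :: 'k \<Rightarrow>\<^sub>0 int)"
    by (rule poly_mapping_eqI) (simp add: lookup_map_int)
  ultimately have "Poly_Mapping.map int (d t) = Poly_Mapping.map int 0"
    using degree_unique[of y "Poly_Mapping.map int (d t)" 0] f_P[of p] f_T[of t] by auto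
  with deg_nonzero[OF \<open>t \<in> T\<close>] show False
    by (simp only: map_int_eq_iff)
qed

definition image_deg :: "'b \<Rightarrow> 'k \<Rightarrow>\<^sub>0 nat" where
  "image_deg y = d (inv_into survivors f y)"

lemma image_deg: "t \<in> survivors \<Longrightarrow> image_deg (f t) = d t"
  by (simp add: image_deg_def inj_on_survivors)

lemma nonzero_mult_image:
  assumes "s \<in> survivors" "t \<in> survivors"
  shows "nonzero_mult (f s) (f t)
    = Option.bind (nonzero_mult s t) (\<lambda>z. if z \<in> survivors then Some (f z) else None)"
proof (cases "f (s * t) = 0")
  case True
  then show ?thesis
    by (simp add: nonzero_mult_def hom(2)[symmetric] survivors_def)
next
  case False
  then have "s * t \<noteq> 0"
    using f_zero by auto
  moreover from this have "s * t \<in> T"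
    using assms by (simp add: T_mult_closed survivors_def)
  ultimately show ?thesis
    using False by (simp add: nonzero_mult_def hom(2)[symmetric] survivors_def)
qed

lemma unitization_image: "unitization (f ` T - {0}) = map_option f ` unitization survivors"
  by (simp add: unitization_def image_survivors[symmetric] image_image)

text \<open>If \<open>f\<close> does not kill a product, then it does not kill its factors.\<close>

lemma survivors_restriction:
  "semigraph_restriction (unitization T) (unitization survivors) (unitization_mult nonzero_mult)
     (unitization_deg d) (map_option f) (unitization_mult nonzero_mult) (unitization_deg image_deg)"
proof
  show "semigraph (unitization T) (unitization_mult nonzero_mult) (unitization_deg d)"
    using T_semigraph by (simp add: nonunital_semigraph_def)
  show "unitization survivors \<subseteq> unitization T"
    by (auto simp: unitization_def survivors_def)
  show "inj_on (map_option f) (unitization survivors)"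
    using inj_on_survivors by (auto simp: unitization_def inj_on_def)
  show "unitization_deg image_deg (map_option f a) = unitization_deg d a"
    if "a \<in> unitization survivors" for a
    using that by (cases a) (auto simp: unitization_def image_deg)
  show "a \<in> unitization survivors \<and> b \<in> unitization survivors"
    if "a \<in> unitization T" "b \<in> unitization T" "unitization_mult nonzero_mult a b = Some z"
      "z \<in> unitization survivors" for a b z
    using that
    by (cases a; cases b)
       (auto simp: unitization_def survivors_def nonzero_mult_def hom(2) split: if_splits)
  show "unitization_mult nonzero_mult (map_option f a) (map_option f b)
    = Option.bind (unitization_mult nonzero_mult a b)
        (\<lambda>z. if z \<in> unitization survivors then Some (map_option f z) else None)"
    if "a \<in> unitization survivors" "b \<in> unitization survivors" for a b
  proof (cases "\<exists>s t. a = Some s \<and> b = Some t")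
    case True
    then obtain s t where "a = Some s" "b = Some t"
      by blast
    moreover from this have "s \<in> survivors" "t \<in> survivors"
      using that by (auto simp: unitization_def)
    ultimately have st: "a = Some s" "b = Some t" "s \<in> survivors" "t \<in> survivors"
      by blast+
    show ?thesis
      using nonzero_mult_image[OF st(3,4)] st
      by (cases "nonzero_mult s t") (auto simp: unitization_def)
  next
    case False
    then show ?thesis
      using that by (cases a; cases b) (auto simp: unitization_def)
  qed
qed

interpretation R: semigraph_restriction "unitization T" "unitization survivors"
    "unitization_mult nonzero_mult" "unitization_deg d" "map_option f"
    "unitization_mult nonzero_mult" "unitization_deg image_deg"
  by (rule survivors_restriction)

definition surviving_extensions :: "'a \<Rightarrow> 'a \<Rightarrow> ('a option \<times> 'a option) set" where
  "surviving_extensions x y = {(\<alpha>, \<beta>) \<in> common_extensions x y.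
     \<exists>z\<in>unitization survivors. unitization_mult nonzero_mult (Some x) \<alpha> = Some z}"

lemma common_extensions_image:
  assumes "x \<in> survivors" "y \<in> survivors"
  shows "min_extensions (unitization (f ` T - {0})) (unitization_mult nonzero_mult)
      (unitization_deg image_deg) (Some (f x)) (Some (f y))
    = map_prod (map_option f) (map_option f) ` surviving_extensions x y"
proof -
  have "Some x \<in> unitization survivors" "Some y \<in> unitization survivors"
    using assms by (simp_all add: unitization_def)
  then show ?thesis
    using R.min_extensions_restricted[of "Some x" "Some y"]
    by (simp only: unitization_image surviving_extensions_def option.map)
qed

lemma surviving_extensions_factors:
  assumes "(\<alpha>, \<beta>) \<in> surviving_extensions x y" "x \<in> T" "y \<in> T"
  shows "\<alpha> \<in> unitization survivors" "\<beta> \<in> unitization survivors"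
proof -
  obtain z where "\<alpha> \<in> unitization T" "\<beta> \<in> unitization T" "z \<in> unitization survivors"
    "unitization_mult nonzero_mult (Some x) \<alpha> = Some z"
    "unitization_mult nonzero_mult (Some y) \<beta> = Some z"
    using assms(1) by (auto simp: surviving_extensions_def min_extensions_def)
  moreover have "Some x \<in> unitization T" "Some y \<in> unitization T"
    using assms by (auto simp: unitization_def)
  ultimately show "\<alpha> \<in> unitization survivors" "\<beta> \<in> unitization survivors"
    using R.factors by blast+
qed

lemma finite_common_extensions:
  assumes "x \<in> T" "y \<in> T"
  shows "finite (common_extensions x y)"
  using T_finitely_aligned assms
  unfolding nonunital_finitely_aligned_def finitely_aligned_def by (simp add: unitization_def)

lemma image_finitely_aligned: "nonunital_finitely_aligned (f ` T - {0}) nonzero_mult image_deg"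
  unfolding nonunital_finitely_aligned_def finitely_aligned_def unitization_image
proof (intro ballI)
  fix x' y' assume "x' \<in> map_option f ` unitization survivors" "y' \<in> map_option f ` unitization survivors"
  then obtain x y where xy: "x' = map_option f x" "y' = map_option f y"
      "x \<in> unitization survivors" "y \<in> unitization survivors" by blast
  then have "finite (min_extensions (unitization T) (unitization_mult nonzero_mult)
      (unitization_deg d) x y)"
    using T_finitely_aligned R.subset
    unfolding nonunital_finitely_aligned_def finitely_aligned_def by blast
  then show "finite (min_extensions (map_option f ` unitization survivors)
      (unitization_mult nonzero_mult) (unitization_deg image_deg) x' y')"
    unfolding xy R.min_extensions_restricted[OF xy(3,4)]
    by (intro finite_imageI) (rule finite_subset, auto)
qed

lemma sandwich_image: "f (sandwich \<alpha> q \<beta>) = sandwich (map_option f \<alpha>) (f q) (map_option f \<beta>)"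
  by (cases \<alpha>; cases \<beta>) (simp_all add: hom)

text \<open>The unit always survives as an extension of a surviving \<open>x\<close>. Any other left factor \<open>a\<close> that is lost
  has \<open>f (x * a) = 0\<close>, and the absorbed source projection exhibits \<open>x * a\<close> as a factor of the term.\<close>

lemma non_surviving_term:
  assumes x: "x \<in> survivors" and ext: "(\<alpha>, \<beta>) \<in> common_extensions x y - surviving_extensions x y"
    and absorb: "x\<^sup>\<star> * x * sandwich \<alpha> q \<beta> = sandwich \<alpha> q \<beta>"
  shows "f (sandwich \<alpha> q \<beta>) = 0"
proof (cases \<alpha>)
  case None
  then show ?thesis
    using ext x by (auto simp: surviving_extensions_def unitization_def)
next
  case (Some a)
  then have "a \<in> T"
    using ext common_extensions_cases by blast
  moreover have "x * a \<noteq> 0"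
    using ext Some by (auto simp: min_extensions_def nonzero_mult_def split: if_splits)
  ultimately have "x * a \<in> T"
    using x by (simp add: T_mult_closed survivors_def)
  then have "f (x * a) = 0"
    using ext Some \<open>x * a \<noteq> 0\<close>
    by (auto simp: surviving_extensions_def unitization_def nonzero_mult_def survivors_def)
  moreover obtain r where "sandwich \<alpha> q \<beta> = a * r"
    using Some by (cases \<beta>) (auto simp: mult.assoc)
  ultimately have "f (x\<^sup>\<star> * x * sandwich \<alpha> q \<beta>) = 0"
    by (simp add: hom mult.assoc) (simp add: mult.assoc[symmetric])
  with absorb show ?thesis by simp
qed

lemma image_adj_mult_expansion:
  assumes x: "x \<in> survivors" and y: "y \<in> survivors"
  shows "\<exists>q. (\<forall>(\<alpha>, \<beta>) \<in> min_extensions (unitization (f ` T - {0})) (unitization_mult nonzero_mult)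
        (unitization_deg image_deg) (Some (f x)) (Some (f y)). q \<alpha> \<beta> \<in> f ` P) \<and>
      (f x)\<^sup>\<star> * f y = (\<Sum>(\<alpha>, \<beta>) \<in> min_extensions (unitization (f ` T - {0}))
        (unitization_mult nonzero_mult) (unitization_deg image_deg) (Some (f x)) (Some (f y)).
        sandwich \<alpha> (q \<alpha> \<beta>) \<beta>)"
proof -
  let ?M = "common_extensions x y"
  let ?S = "surviving_extensions x y"
  let ?e = "map_prod (map_option f) (map_option f)"
  have xy: "x \<in> T" "y \<in> T"
    using x y by (simp_all add: survivors_def)
  obtain q where q: "\<And>\<alpha> \<beta>. (\<alpha>, \<beta>) \<in> ?M \<Longrightarrow> q \<alpha> \<beta> \<in> P"
    and absorb: "\<And>\<alpha> \<beta>. (\<alpha>, \<beta>) \<in> ?M \<Longrightarrow>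
      x\<^sup>\<star> * x * sandwich \<alpha> (q \<alpha> \<beta>) \<beta> = sandwich \<alpha> (q \<alpha> \<beta>) \<beta>"
    and exp: "x\<^sup>\<star> * y = (\<Sum>(\<alpha>, \<beta>)\<in>?M. sandwich \<alpha> (q \<alpha> \<beta>) \<beta>)"
    using adj_mult_expansion_normalized[OF xy] by blast
  let ?inv = "inv_into (unitization survivors) (map_option f)"
  define q' where "q' \<alpha> \<beta> = f (q (?inv \<alpha>) (?inv \<beta>))" for \<alpha> \<beta>
  have S_M: "?S \<subseteq> ?M"
    by (auto simp: surviving_extensions_def)
  have q': "q' (map_option f \<alpha>) (map_option f \<beta>) = f (q \<alpha> \<beta>)" if "(\<alpha>, \<beta>) \<in> ?S" for \<alpha> \<beta>
    using surviving_extensions_factors[OF that xy] by (simp add: q'_def R.inj)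
  have inj: "inj_on ?e ?S"
    unfolding surviving_extensions_def
    using x y by (intro R.inj_on_min_extensions_restricted) (auto simp: unitization_def)
  have "(f x)\<^sup>\<star> * f y = f (x\<^sup>\<star> * y)"
    by (simp add: hom)
  also have "\<dots> = (\<Sum>(\<alpha>, \<beta>)\<in>?M. f (sandwich \<alpha> (q \<alpha> \<beta>) \<beta>))"
    unfolding exp star_hom_sum[OF f] by (intro sum.cong) auto
  also have "\<dots> = (\<Sum>(\<alpha>, \<beta>)\<in>?S. f (sandwich \<alpha> (q \<alpha> \<beta>) \<beta>))"
    using finite_common_extensions[OF xy] S_M non_surviving_term[OF x] absorb
    by (intro sum.mono_neutral_right) auto
  also have "\<dots> = (\<Sum>p\<in>?S. (\<lambda>(\<alpha>, \<beta>). sandwich \<alpha> (q' \<alpha> \<beta>) \<beta>) (?e p))"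
    using q' by (intro sum.cong) (auto simp: sandwich_image)
  also have "\<dots> = (\<Sum>(\<alpha>, \<beta>)\<in>?e ` ?S. sandwich \<alpha> (q' \<alpha> \<beta>) \<beta>)"
    using sum.reindex[OF inj, of "\<lambda>(\<alpha>, \<beta>). sandwich \<alpha> (q' \<alpha> \<beta>) \<beta>"] by (simp add: comp_def)
  finally have "(f x)\<^sup>\<star> * f y = (\<Sum>(\<alpha>, \<beta>)\<in>?e ` ?S. sandwich \<alpha> (q' \<alpha> \<beta>) \<beta>)" .
  moreover have "\<forall>(\<alpha>, \<beta>)\<in>?e ` ?S. q' \<alpha> \<beta> \<in> f ` P"
    using q' subsetD[OF S_M, THEN q] by auto
  ultimately show ?thesis
    unfolding common_extensions_image[OF x y] by blast
qed

lemma image_generated: "is_star_subalgebra hull (f ` P \<union> (f ` T - {0})) = UNIV"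
proof -
  let ?H = "is_star_subalgebra hull (f ` P \<union> (f ` T - {0}))"
  have H: "is_star_subalgebra ?H"
    by (rule hull_in) (auto simp: is_star_subalgebra_def)
  then have "is_star_subalgebra (f -` ?H)"
    by (auto simp: is_star_subalgebra_def hom f_zero)
  moreover have "P \<union> T \<subseteq> f -` ?H"
  proof
    fix a assume "a \<in> P \<union> T"
    then have "f a = 0 \<or> f a \<in> f ` P \<union> (f ` T - {0})"
      by auto
    then show "a \<in> f -` ?H"
      using H hull_inc[of "f a" _ is_star_subalgebra] by (auto simp: is_star_subalgebra_def)
  qed
  ultimately have "UNIV \<subseteq> f -` ?H"
    unfolding generated[symmetric] by (rule hull_minimal[rotated])
  with surj show ?thesis
    by (metis UNIV_eq_I subsetD surjD vimageE UNIV_I)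
qed

lemma image_semigraph_algebra: "semigraph_algebra (f ` P) (f ` T - {0}) image_deg"
proof
  show "f ` P \<inter> (f ` T - {0}) = {}"
    by (rule images_disjoint)
  show "is_star_subalgebra hull (f ` P \<union> (f ` T - {0})) = UNIV"
    by (rule image_generated)
  show "is_projection p" if "p \<in> f ` P" for p
    using that projections unfolding is_projection_def by (auto simp flip: hom)
  show "p * q = q * p" if "p \<in> f ` P" "q \<in> f ` P" for p q
    using that P_commute by (auto simp flip: hom)
  show "p * q \<in> f ` P" if "p \<in> f ` P" "q \<in> f ` P" for p q
    using that P_mult_closed by (auto simp flip: hom)
  show "0 \<notin> f ` T - {0}"
    by simp
  show "is_partial_isometry t" if "t \<in> f ` T - {0}" for t
    using that partial_isometries unfolding is_partial_isometry_def by (auto simp flip: hom)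
  show "s * t \<in> f ` T - {0}" if st_nonzero: "s \<in> f ` T - {0}" "t \<in> f ` T - {0}" "s * t \<noteq> 0" for s t
  proof -
    obtain s' t' where st: "s = f s'" "t = f t'" "s' \<in> T" "t' \<in> T"
      using st_nonzero(1,2) by blast
    then have "s' * t' \<noteq> 0"
      using st_nonzero(3) f_zero by (metis hom(2))
    then have "s' * t' \<in> T"
      using st T_mult_closed by blast
    then show ?thesis
      using st_nonzero(3) st by (auto simp flip: hom)
  qed
  show "nonunital_semigraph (f ` T - {0}) nonzero_mult image_deg"
    unfolding nonunital_semigraph_def unitization_image by (rule R.semigraph_restricted)
  show "nonunital_finitely_aligned (f ` T - {0}) nonzero_mult image_deg"
    by (rule image_finitely_aligned)
  show "\<exists>q\<in>f ` P. p * x = x * q" if x_p: "x \<in> f ` T - {0}" "p \<in> f ` P" for x p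
  proof -
    obtain x' p' where xp: "x = f x'" "p = f p'" "x' \<in> T" "p' \<in> P"
      using x_p by blast
    then obtain q where "q \<in> P" "p' * x' = x' * q"
      using P_T_exchange by blast
    then have "f q \<in> f ` P" "p * x = x * f q"
      unfolding xp by (auto simp flip: hom)
    then show ?thesis by blast
  qed
  show "\<exists>q. (\<forall>(\<alpha>, \<beta>) \<in> min_extensions (unitization (f ` T - {0})) (unitization_mult nonzero_mult)
        (unitization_deg image_deg) (Some x) (Some y). q \<alpha> \<beta> \<in> f ` P) \<and>
      x\<^sup>\<star> * y = (\<Sum>(\<alpha>, \<beta>) \<in> min_extensions (unitization (f ` T - {0}))
        (unitization_mult nonzero_mult) (unitization_deg image_deg) (Some x) (Some y).
        sandwich \<alpha> (q \<alpha> \<beta>) \<beta>)"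
    if x_y: "x \<in> f ` T - {0}" "y \<in> f ` T - {0}" for x y
  proof -
    obtain x' y' where "x = f x'" "y = f y'" "x' \<in> survivors" "y' \<in> survivors"
      using x_y unfolding image_survivors[symmetric] by blast
    then show ?thesis
      using image_adj_mult_expansion by simp
  qed
  show "\<exists>R \<subseteq> free_fiber_space (f ` P) (f ` T - {0}) image_deg.
      {\<phi> \<in> free_on (f ` T - {0} \<union> f ` P). canonical_map \<phi> = 0}
      = star_ideal_generated (free_on (f ` T - {0} \<union> f ` P)) R"
  proof (rule fiber_relations_of_homogeneous_generators[OF grading images_disjoint])
    show "p \<in> V 0" if "p \<in> f ` P" for p
      using that f_P by auto
    show "t \<in> V (Poly_Mapping.map int (image_deg t))" if t: "t \<in> f ` T - {0}" for t
    proof -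
      obtain s where "t = f s" "s \<in> survivors"
        using t unfolding image_survivors[symmetric] by blast
      then show ?thesis
        using f_T[of s] by (simp add: image_deg survivors_def)
    qed
  qed
qed

end


section \<open>Quotients of semigraph algebras\<close>

text \<open>The relations among the generators are homogeneous, so the degree of words descends to the
  algebra.\<close>

lemma (in semigraph_algebra) fiber_grading:
  "star_grading UNIV (\<lambda>n. canonical_map ` free_fiber P T d n)"
proof -
  obtain R where R: "R \<subseteq> (\<Union>n. free_fiber P T d n)"
      "{\<phi> \<in> free_on (T \<union> P). canonical_map \<phi> = 0} = star_ideal_generated (free_on (T \<union> P)) R"
    using fiber_relations unfolding free_fiber_space_def by blast
  have "canonical_map ` free_on (T \<union> P) = UNIV"
    using generated by (intro canonical_map_onto_generated) (simp add: Un_commute)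
  then show ?thesis
    using star_grading.quotient_grading[OF free_star_grading canonical_map_hom R(2,1)] by simp
qed

lemma free_generator_in_free_fiber:
  "a \<in> T \<union> P \<Longrightarrow> free_generator a \<in> free_fiber P T d (gen_deg T d a)"
  using free_generator_in_free_on[of a "T \<union> P"]
  by (auto simp: free_fiber_def free_generator.rep_eq word_deg_def)

theorem lemma8p1:
  fixes P T S :: "'a::complex_star_algebra set"
    and d :: "'a \<Rightarrow> 'k \<Rightarrow>\<^sub>0 nat"
    and f :: "'a \<Rightarrow> 'b::complex_star_algebra"
  assumes "semigraph_algebra P T d"
    and "S \<subseteq> fiber_space P T d"
    and "is_quotient_map f S"
  shows "(\<exists>d' :: 'b \<Rightarrow> 'k \<Rightarrow>\<^sub>0 nat. semigraph_algebra (f ` P) (f ` T - {0}) d') \<and>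
    bij_betw f {t \<in> T. f t \<in> f ` T - {0}} (f ` T - {0})"
proof -
  interpret semigraph_algebra P T d
    by (rule assms(1))
  let ?V = "\<lambda>n. f ` canonical_map ` free_fiber P T d n"
  have f: "is_star_hom f" "surj f" "{x \<in> UNIV. f x = 0} = star_ideal_generated UNIV S"
    using assms(3) by (auto simp: is_quotient_map_def)
  have S: "S \<subseteq> (\<Union>n. canonical_map ` free_fiber P T d n)"
    using assms(2) by (simp only: fiber_space_def free_fiber_space_def image_UN)
  have grading: "star_grading UNIV ?V"
    using star_grading.quotient_grading[OF fiber_grading f(1,3) S] f(2) by simp
  have generator: "f a \<in> ?V (gen_deg T d a)" if "a \<in> T \<union> P" for a
    using imageI[OF imageI[OF free_generator_in_free_fiber[OF that, of d], of canonical_map], of f]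
    by (simp add: canonical_map_free_generator)
  interpret homogeneous_image P T d f ?V
  proof (intro homogeneous_image.intro homogeneous_image_axioms.intro assms(1))
    show "star_grading UNIV ?V"
      by (rule grading)
    show "is_star_hom f" "surj f"
      by (fact f)+
    show "f p \<in> ?V 0" if "p \<in> P" for p
      using generator[of p] that disjoint by (auto simp: gen_deg_def split: if_splits)
    show "f t \<in> ?V (Poly_Mapping.map int (d t))" if "t \<in> T" for t
      using generator[of t] that by (simp add: gen_deg_def)
  qed
  have "{t \<in> T. f t \<in> f ` T - {0}} = survivors"
    by (auto simp: survivors_def)
  then have "bij_betw f {t \<in> T. f t \<in> f ` T - {0}} (f ` T - {0})"
    using inj_on_survivors image_survivors by (simp add: bij_betw_def)
  then show ?thesis
    using image_semigraph_algebra by blast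
qed

end
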